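(* Let $A\in\mathcal{V}$ and $U\subseteq Max(A)$. Then $U$ is a clopen subset of $Max(A)$ if and only if there exist $\alpha,\beta\in K(A)$ such that $\alpha\vee\beta=\nabla_A$, $[\alpha,\beta]\subseteq Rad(A)$ and $U=Max(A)\cap D_A(\alpha)$.
   Context: $\mathcal{V}$ is a congruence modular, semidegenerate variety (no nontrivial algebra has a one-element subalgebra) of finite signature. For $B\in\mathcal{V}$: $Con(B)$ is its congruence lattice with bounds $\Delta_B,\nabla_B$, $[\cdot,\cdot]$ the Freese–McKenzie commutator, $K(B)$ the compact congruences. A congruence $\phi\neq\nabla_B$ is prime if $[\alpha,\beta]\subseteq\phi$ implies $\alpha\subseteq\phi$ or $\beta\subseteq\phi$; $Spec(B)$ is the set of primes, $Max(B)\subseteq Spec(B)$ the set of maximal congruences, $Rad(B)=\bigcap Max(B)$; $\rho(\theta)$ is the intersection of primes containing $\theta$. $D_B(\theta)=\{\phi\in Spec(B):\theta\not\subseteq\phi\}$; these sets are the open sets of a topology on $Spec(B)$, and $Max(B)$ has the subspace topology. $B(Con(B))$ is the Boolean algebra of complemented elements of $Con(B)$. When $K(B)$ is closed under the commutator, the reticulation $L(B)=K(B)/{\equiv}$ ($\alpha\equiv\beta$ iff $\rho(\alpha)=\rho(\beta)$) is a bounded distributive lattice with canonical map $\lambda_B$, mapping $B(Con(B))$ injectively into $B(L(B))$; the reticulation preserves the Boolean center if this map is onto $B(L(B))$. Standing assumption: for every $B\in\mathcal{V}$, $K(B)$ is closed under the commutator and the reticulation of $B$ preserves the Boolean center. 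*)

theory Defs
  imports Main
begin

datatype ('f,'v) trm = Var 'v | Fn 'f "('f,'v) trm list"

record ('f,'a) alg =
  acar :: "'a set"
  aop  :: "'f \<Rightarrow> 'a list \<Rightarrow> 'a"

fun wf_trm :: "('f \<Rightarrow> nat) \<Rightarrow> ('f,'v) trm \<Rightarrow> bool" where
  "wf_trm ar (Var v) = True"
| "wf_trm ar (Fn f ts) = (length ts = ar f \<and> list_all (wf_trm ar) ts)"

fun eval :: "('f,'a,'z) alg_scheme \<Rightarrow> ('v \<Rightarrow> 'a) \<Rightarrow> ('f,'v) trm \<Rightarrow> 'a" where
  "eval A \<sigma> (Var v) = \<sigma> v"
| "eval A \<sigma> (Fn f ts) = aop A f (map (eval A \<sigma>) ts)"

definition is_alg :: "('f \<Rightarrow> nat) \<Rightarrow> ('f,'a) alg \<Rightarrow> bool" where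
  "is_alg ar A \<longleftrightarrow> acar A \<noteq> {} \<and>
     (\<forall>f xs. length xs = ar f \<and> set xs \<subseteq> acar A \<longrightarrow> aop A f xs \<in> acar A)"

definition satisfies :: "('f,'a) alg \<Rightarrow> (('f,nat) trm \<times> ('f,nat) trm) set \<Rightarrow> bool" where
  "satisfies A E \<longleftrightarrow> (\<forall>(s,t)\<in>E. \<forall>\<sigma>. range \<sigma> \<subseteq> acar A \<longrightarrow> eval A \<sigma> s = eval A \<sigma> t)"

definition in_V :: "('f \<Rightarrow> nat) \<Rightarrow> (('f,nat) trm \<times> ('f,nat) trm) set \<Rightarrow> ('f,'a) alg \<Rightarrow> bool" where
  "in_V ar E A \<longleftrightarrow> is_alg ar A \<and> satisfies A E"

definition subuniverse :: "('f \<Rightarrow> nat) \<Rightarrow> ('f,'a) alg \<Rightarrow> 'a set \<Rightarrow> bool" where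
  "subuniverse ar A S \<longleftrightarrow> S \<subseteq> acar A \<and>
     (\<forall>f xs. length xs = ar f \<and> set xs \<subseteq> S \<longrightarrow> aop A f xs \<in> S)"

definition Con :: "('f \<Rightarrow> nat) \<Rightarrow> ('f,'a) alg \<Rightarrow> ('a \<times> 'a) set set" where
  "Con ar A = {\<theta>. equiv (acar A) \<theta> \<and>
     (\<forall>f xs ys. length xs = ar f \<and> length ys = ar f \<and> list_all2 (\<lambda>x y. (x,y) \<in> \<theta>) xs ys
        \<longrightarrow> (aop A f xs, aop A f ys) \<in> \<theta>)}"

definition Delta :: "('f,'a) alg \<Rightarrow> ('a \<times> 'a) set" where
  "Delta A = Id_on (acar A)"

definition Nabla :: "('f,'a) alg \<Rightarrow> ('a \<times> 'a) set" where
  "Nabla A = acar A \<times> acar A"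

definition Cg :: "('f \<Rightarrow> nat) \<Rightarrow> ('f,'a) alg \<Rightarrow> ('a \<times> 'a) set \<Rightarrow> ('a \<times> 'a) set" where
  "Cg ar A X = \<Inter>{\<theta> \<in> Con ar A. X \<subseteq> \<theta>}"

definition cjoin :: "('f \<Rightarrow> nat) \<Rightarrow> ('f,'a) alg \<Rightarrow> ('a \<times> 'a) set \<Rightarrow> ('a \<times> 'a) set \<Rightarrow> ('a \<times> 'a) set" where
  "cjoin ar A \<alpha> \<beta> = Cg ar A (\<alpha> \<union> \<beta>)"

text \<open>Compact elements of the complete lattice Con(A) (arbitrary joins are Cg of unions).\<close>
definition K :: "('f \<Rightarrow> nat) \<Rightarrow> ('f,'a) alg \<Rightarrow> ('a \<times> 'a) set set" where
  "K ar A = {\<theta> \<in> Con ar A. \<forall>S \<subseteq> Con ar A. \<theta> \<subseteq> Cg ar A (\<Union>S) \<longrightarrow>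
      (\<exists>T \<subseteq> S. finite T \<and> \<theta> \<subseteq> Cg ar A (\<Union>T))}"

text \<open>C(alpha,beta;delta): alpha centralizes beta modulo delta. Variables Inl i are the
  x-variables (alpha-related tuples), Inr j the y-variables (beta-related tuples).\<close>
definition centralizes :: "('f \<Rightarrow> nat) \<Rightarrow> ('f,'a) alg \<Rightarrow> ('a \<times> 'a) set \<Rightarrow> ('a \<times> 'a) set \<Rightarrow> ('a \<times> 'a) set \<Rightarrow> bool" where
  "centralizes ar A \<alpha> \<beta> \<delta> \<longleftrightarrow>
     (\<forall>t :: ('f, nat + nat) trm. wf_trm ar t \<longrightarrow>
       (\<forall>a b c d. (\<forall>i. (a i, b i) \<in> \<alpha>) \<and> (\<forall>j. (c j, d j) \<in> \<beta>) \<longrightarrow>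
          (eval A (case_sum a c) t, eval A (case_sum a d) t) \<in> \<delta> \<longrightarrow>
          (eval A (case_sum b c) t, eval A (case_sum b d) t) \<in> \<delta>))"

definition comm :: "('f \<Rightarrow> nat) \<Rightarrow> ('f,'a) alg \<Rightarrow> ('a \<times> 'a) set \<Rightarrow> ('a \<times> 'a) set \<Rightarrow> ('a \<times> 'a) set" where
  "comm ar A \<alpha> \<beta> = \<Inter>{\<delta> \<in> Con ar A. centralizes ar A \<alpha> \<beta> \<delta>}"

definition Spec :: "('f \<Rightarrow> nat) \<Rightarrow> ('f,'a) alg \<Rightarrow> ('a \<times> 'a) set set" where
  "Spec ar A = {\<phi> \<in> Con ar A. \<phi> \<noteq> Nabla A \<and>
     (\<forall>\<alpha>\<in>Con ar A. \<forall>\<beta>\<in>Con ar A. comm ar A \<alpha> \<beta> \<subseteq> \<phi> \<longrightarrow> \<alpha> \<subseteq> \<phi> \<or> \<beta> \<subseteq> \<phi>)}"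

definition MaxC :: "('f \<Rightarrow> nat) \<Rightarrow> ('f,'a) alg \<Rightarrow> ('a \<times> 'a) set set" where
  "MaxC ar A = {\<phi> \<in> Con ar A. \<phi> \<noteq> Nabla A \<and>
     (\<forall>\<psi>\<in>Con ar A. \<phi> \<subseteq> \<psi> \<longrightarrow> \<psi> = \<phi> \<or> \<psi> = Nabla A)}"

text \<open>Meets in Con(A) are intersections; the empty meet is Nabla.\<close>
definition Rad :: "('f \<Rightarrow> nat) \<Rightarrow> ('f,'a) alg \<Rightarrow> ('a \<times> 'a) set" where
  "Rad ar A = Nabla A \<inter> \<Inter>(MaxC ar A)"

definition rho :: "('f \<Rightarrow> nat) \<Rightarrow> ('f,'a) alg \<Rightarrow> ('a \<times> 'a) set \<Rightarrow> ('a \<times> 'a) set" where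
  "rho ar A \<theta> = Nabla A \<inter> \<Inter>{\<phi> \<in> Spec ar A. \<theta> \<subseteq> \<phi>}"

definition D :: "('f \<Rightarrow> nat) \<Rightarrow> ('f,'a) alg \<Rightarrow> ('a \<times> 'a) set \<Rightarrow> ('a \<times> 'a) set set" where
  "D ar A \<theta> = {\<phi> \<in> Spec ar A. \<not> \<theta> \<subseteq> \<phi>}"

text \<open>Open sets of Max(A) in the subspace topology: traces of the opens D(theta) of Spec(A).\<close>
definition Max_open :: "('f \<Rightarrow> nat) \<Rightarrow> ('f,'a) alg \<Rightarrow> ('a \<times> 'a) set set \<Rightarrow> bool" where
  "Max_open ar A U \<longleftrightarrow> (\<exists>\<theta>\<in>Con ar A. U = MaxC ar A \<inter> D ar A \<theta>)"

definition Max_clopen :: "('f \<Rightarrow> nat) \<Rightarrow> ('f,'a) alg \<Rightarrow> ('a \<times> 'a) set set \<Rightarrow> bool" where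
  "Max_clopen ar A U \<longleftrightarrow> U \<subseteq> MaxC ar A \<and> Max_open ar A U \<and> Max_open ar A (MaxC ar A - U)"

definition complemented_con :: "('f \<Rightarrow> nat) \<Rightarrow> ('f,'a) alg \<Rightarrow> ('a \<times> 'a) set \<Rightarrow> bool" where
  "complemented_con ar A \<theta> \<longleftrightarrow> \<theta> \<in> Con ar A \<and>
     (\<exists>\<psi>\<in>Con ar A. \<theta> \<inter> \<psi> = Delta A \<and> cjoin ar A \<theta> \<psi> = Nabla A)"

text \<open>L(A) = K(A)/\<equiv>, with the class of alpha below the class of beta iff rho alpha \<subseteq> rho beta;
  bottom = class of Delta, top = class of Nabla. ret_complemented says that the class of alpha
  lies in the Boolean center B(L(A)) (meet = 0 and join = 1 expressed order-theoretically).\<close>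
definition ret_le :: "('f \<Rightarrow> nat) \<Rightarrow> ('f,'a) alg \<Rightarrow> ('a \<times> 'a) set \<Rightarrow> ('a \<times> 'a) set \<Rightarrow> bool" where
  "ret_le ar A \<alpha> \<beta> \<longleftrightarrow> rho ar A \<alpha> \<subseteq> rho ar A \<beta>"

definition ret_complemented :: "('f \<Rightarrow> nat) \<Rightarrow> ('f,'a) alg \<Rightarrow> ('a \<times> 'a) set \<Rightarrow> bool" where
  "ret_complemented ar A \<alpha> \<longleftrightarrow> \<alpha> \<in> K ar A \<and> (\<exists>\<beta>\<in>K ar A.
     (\<forall>\<gamma>\<in>K ar A. ret_le ar A \<gamma> \<alpha> \<and> ret_le ar A \<gamma> \<beta> \<longrightarrow> ret_le ar A \<gamma> (Delta A)) \<and>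
     (\<forall>\<gamma>\<in>K ar A. ret_le ar A \<alpha> \<gamma> \<and> ret_le ar A \<beta> \<gamma> \<longrightarrow> ret_le ar A (Nabla A) \<gamma>))"

text \<open>lambda_A maps B(Con(A)) onto B(L(A)).\<close>
definition preserves_boolean_center :: "('f \<Rightarrow> nat) \<Rightarrow> ('f,'a) alg \<Rightarrow> bool" where
  "preserves_boolean_center ar A \<longleftrightarrow>
     (\<forall>\<alpha>\<in>K ar A. ret_complemented ar A \<alpha> \<longrightarrow>
        (\<exists>\<theta>. complemented_con ar A \<theta> \<and> \<theta> \<in> K ar A \<and> rho ar A \<theta> = rho ar A \<alpha>))"

definition std_V :: "'u itself \<Rightarrow> ('f \<Rightarrow> nat) \<Rightarrow> (('f,nat) trm \<times> ('f,nat) trm) set \<Rightarrow> bool" where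
  "std_V (_ :: 'u itself) ar E \<longleftrightarrow>
    (\<forall>B :: ('f,'u) alg. in_V ar E B \<longrightarrow>
       \<comment> \<open>congruence modular\<close>
       (\<forall>\<alpha>\<in>Con ar B. \<forall>\<beta>\<in>Con ar B. \<forall>\<gamma>\<in>Con ar B. \<alpha> \<subseteq> \<gamma> \<longrightarrow>
           cjoin ar B \<alpha> (\<beta> \<inter> \<gamma>) = cjoin ar B \<alpha> \<beta> \<inter> \<gamma>) \<and>
       \<comment> \<open>semidegenerate\<close>
       ((\<exists>x\<in>acar B. \<exists>y\<in>acar B. x \<noteq> y) \<longrightarrow> \<not> (\<exists>x\<in>acar B. subuniverse ar B {x})) \<and>
       \<comment> \<open>K(B) closed under the commutator\<close>
       (\<forall>\<alpha>\<in>K ar B. \<forall>\<beta>\<in>K ar B. comm ar B \<alpha> \<beta> \<in> K ar B) \<and>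
       \<comment> \<open>the reticulation preserves the Boolean center\<close>
       preserves_boolean_center ar B)"

end

theory Submission
  imports Defs "HOL-Library.Nat_Bijection"
begin

text \<open>The topological part is easy once maximal congruences are known to be prime and \<open>\<nabla>\<close> to be
  compact. In a semidegenerate variety a congruence having a subalgebra as a class is \<open>\<nabla>\<close>. Hence
  the finitely many pairs \<open>(f(x,\<dots>,x), x)\<close> already generate \<open>\<nabla>\<close>.

  For primality let \<open>\<phi>\<close> be maximal, \<open>[\<alpha>,\<beta>] \<subseteq> \<phi>\<close> and \<open>\<not> \<alpha> \<subseteq> \<phi>\<close>. Regard \<open>\<beta>\<close> as a subalgebra of the
  square of \<open>A\<close>, with the congruence \<open>\<Delta>\<close> generated by the pairs \<open>((x,x),(y,y))\<close>, \<open>(x,y) \<in> \<alpha>\<close>. The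
  term condition says that \<open>[\<alpha>,\<beta>]\<close> is a union of \<open>\<Delta>\<close>-classes; two applications of Gumm's Shifting
  Lemma give the same for \<open>\<beta> \<inter> \<phi>\<close>. The join of \<open>\<Delta>\<close> with the restriction of \<open>\<phi> \<times> \<phi>\<close> collapses the
  diagonal, because \<open>\<alpha> \<or> \<phi> = \<nabla>\<close>, so it is the full congruence of \<open>\<beta>\<close>; but \<open>\<beta> \<inter> \<phi>\<close> is a union of
  its classes, whence \<open>\<beta> \<subseteq> \<phi>\<close>.\<close>

section \<open>Congruences\<close>

lemma Con_subset: "\<theta> \<in> Con ar A \<Longrightarrow> \<theta> \<subseteq> acar A \<times> acar A"
  by (simp add: Con_def equiv_def)

lemma Con_refl: "\<theta> \<in> Con ar A \<Longrightarrow> x \<in> acar A \<Longrightarrow> (x, x) \<in> \<theta>"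
  by (simp add: Con_def equiv_def refl_on_def)

lemma Con_sym: "\<theta> \<in> Con ar A \<Longrightarrow> (x, y) \<in> \<theta> \<Longrightarrow> (y, x) \<in> \<theta>"
  by (simp add: Con_def equiv_def sym_def)

lemma Con_trans: "\<theta> \<in> Con ar A \<Longrightarrow> (x, y) \<in> \<theta> \<Longrightarrow> (y, z) \<in> \<theta> \<Longrightarrow> (x, z) \<in> \<theta>"
  unfolding Con_def equiv_def trans_def by blast

lemma Con_compat:
  "\<theta> \<in> Con ar A \<Longrightarrow> length xs = ar f \<Longrightarrow> list_all2 (\<lambda>x y. (x, y) \<in> \<theta>) xs ys
    \<Longrightarrow> (aop A f xs, aop A f ys) \<in> \<theta>"
  unfolding Con_def using list_all2_lengthD by fastforce

lemma ConI:
  assumes "\<theta> \<subseteq> acar A \<times> acar A"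
    and "\<And>x. x \<in> acar A \<Longrightarrow> (x, x) \<in> \<theta>"
    and "\<And>x y. (x, y) \<in> \<theta> \<Longrightarrow> (y, x) \<in> \<theta>"
    and "\<And>x y z. (x, y) \<in> \<theta> \<Longrightarrow> (y, z) \<in> \<theta> \<Longrightarrow> (x, z) \<in> \<theta>"
    and "\<And>f xs ys. length xs = ar f \<Longrightarrow> length ys = ar f \<Longrightarrow>
      list_all2 (\<lambda>x y. (x, y) \<in> \<theta>) xs ys \<Longrightarrow> (aop A f xs, aop A f ys) \<in> \<theta>"
  shows "\<theta> \<in> Con ar A"
  unfolding Con_def equiv_def refl_on_def sym_def trans_def
  by (intro CollectI conjI allI impI ballI; (elim conjE)?; fact | rule assms; assumption)

lemma is_algD:
  "is_alg ar A \<Longrightarrow> length xs = ar f \<Longrightarrow> set xs \<subseteq> acar A \<Longrightarrow> aop A f xs \<in> acar A"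
  by (simp add: is_alg_def)

lemma list_all2_carrier:
  assumes "list_all2 (\<lambda>x y. (x, y) \<in> \<theta>) xs ys" "\<theta> \<subseteq> X \<times> Y"
  shows "set xs \<subseteq> X" "set ys \<subseteq> Y"
  using assms(1) by (induction rule: list_all2_induct) (use assms(2) in auto)

lemma Nabla_in_Con: "is_alg ar A \<Longrightarrow> Nabla A \<in> Con ar A"
  by (rule ConI)
    (auto simp: Nabla_def list_all2_conv_all_nth in_set_conv_nth intro!: is_algD)

lemma Delta_in_Con:
  assumes "is_alg ar A"
  shows "Delta A \<in> Con ar A"
proof (rule ConI)
  fix f xs ys
  assume l: "length xs = ar f" "list_all2 (\<lambda>x y. (x, y) \<in> Delta A) xs ys"
  have "set xs \<subseteq> acar A"
    by (rule list_all2_carrier(1)[OF l(2), of _ UNIV]) (auto simp: Delta_def)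
  moreover have "xs = ys"
    using l(2) by (auto simp: list_all2_conv_all_nth Delta_def Id_on_iff intro!: nth_equalityI)
  ultimately show "(aop A f xs, aop A f ys) \<in> Delta A"
    using is_algD[OF assms l(1)] by (simp add: Delta_def Id_on_iff)
qed (auto simp: Delta_def)

lemma Inter_in_Con:
  assumes "S \<subseteq> Con ar A" "S \<noteq> {}"
  shows "\<Inter>S \<in> Con ar A"
proof (rule ConI)
  show "\<Inter>S \<subseteq> acar A \<times> acar A"
    using assms Con_subset by blast
next
  fix x y assume "(x, y) \<in> \<Inter>S"
  then show "(y, x) \<in> \<Inter>S" using assms(1) by (blast intro: Con_sym)
next
  fix x y z assume "(x, y) \<in> \<Inter>S" "(y, z) \<in> \<Inter>S"
  then show "(x, z) \<in> \<Inter>S" using assms(1) by (blast intro: Con_trans)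
next
  fix f xs ys assume "length xs = ar f" "list_all2 (\<lambda>x y. (x, y) \<in> \<Inter>S) xs ys"
  moreover have "list_all2 (\<lambda>x y. (x, y) \<in> \<theta>) xs ys" if "\<theta> \<in> S" for \<theta>
    using calculation(2) that by (auto elim!: list_all2_mono)
  ultimately show "(aop A f xs, aop A f ys) \<in> \<Inter>S"
    using assms(1) by (blast intro: Con_compat)
qed (use assms(1) in \<open>auto intro: Con_refl\<close>)

lemma Int_in_Con: "\<theta> \<in> Con ar A \<Longrightarrow> \<psi> \<in> Con ar A \<Longrightarrow> \<theta> \<inter> \<psi> \<in> Con ar A"
  using Inter_in_Con[of "{\<theta>, \<psi>}" ar A] by simp

section \<open>Generated congruences and compactness\<close>

lemma Cg_in_Con:
  assumes "is_alg ar A" "X \<subseteq> acar A \<times> acar A"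
  shows "Cg ar A X \<in> Con ar A"
  unfolding Cg_def
  using assms Nabla_in_Con[OF assms(1)] by (intro Inter_in_Con) (auto simp: Nabla_def)

lemma subset_Cg: "X \<subseteq> Cg ar A X"
  by (auto simp: Cg_def)

lemma Cg_least: "\<theta> \<in> Con ar A \<Longrightarrow> X \<subseteq> \<theta> \<Longrightarrow> Cg ar A X \<subseteq> \<theta>"
  by (auto simp: Cg_def)

lemma Cg_mono: "X \<subseteq> Y \<Longrightarrow> Cg ar A X \<subseteq> Cg ar A Y"
  by (auto simp: Cg_def)

text \<open>Operations are finitary: the finitely many pairs involved in one application already lie
  in a single member of the directed family.\<close>

lemma directed_Union_in_Con:
  assumes "is_alg ar A" "S \<subseteq> Con ar A" "S \<noteq> {}"
    and dir: "\<And>X Y. X \<in> S \<Longrightarrow> Y \<in> S \<Longrightarrow> \<exists>Z\<in>S. X \<union> Y \<subseteq> Z"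
  shows "\<Union>S \<in> Con ar A"
proof (rule ConI)
  show "\<Union>S \<subseteq> acar A \<times> acar A" using assms(2) Con_subset by blast
  show "(x, x) \<in> \<Union>S" if "x \<in> acar A" for x
    using that assms(2,3) by (auto simp: subset_iff ex_in_conv[symmetric] intro: Con_refl)
  show "(y, x) \<in> \<Union>S" if "(x, y) \<in> \<Union>S" for x y
    using that assms(2) by (auto intro: Con_sym)
next
  fix x y z assume "(x, y) \<in> \<Union>S" "(y, z) \<in> \<Union>S"
  then obtain X Y where "X \<in> S" "Y \<in> S" "(x, y) \<in> X" "(y, z) \<in> Y" by blast
  moreover then obtain Z where "Z \<in> S" "X \<union> Y \<subseteq> Z" using dir by blast
  ultimately show "(x, z) \<in> \<Union>S" using assms(2) Con_trans[of Z ar A x y z] by blast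
next
  fix f xs ys assume l: "length xs = ar f" "list_all2 (\<lambda>x y. (x, y) \<in> \<Union>S) xs ys"
  from l(2) have "\<exists>Z\<in>S. list_all2 (\<lambda>x y. (x, y) \<in> Z) xs ys"
  proof (induction rule: list_all2_induct)
    case Nil
    then show ?case using assms(3) by auto
  next
    case (Cons x xs y ys)
    then obtain X Z where XZ: "X \<in> S" "(x, y) \<in> X" "Z \<in> S" "list_all2 (\<lambda>x y. (x, y) \<in> Z) xs ys"
      by blast
    then obtain W where "W \<in> S" "X \<union> Z \<subseteq> W" using dir by blast
    then have "list_all2 (\<lambda>x y. (x, y) \<in> W) (x # xs) (y # ys)"
      using XZ by (auto elim: list_all2_mono)
    then show ?case using \<open>W \<in> S\<close> by blast
  qed
  then obtain Z where "Z \<in> S" "list_all2 (\<lambda>x y. (x, y) \<in> Z) xs ys" ..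
  then show "(aop A f xs, aop A f ys) \<in> \<Union>S"
    using Con_compat[of Z ar A xs f ys] l(1) assms(2) by blast
qed

text \<open>The congruences generated by finite subsets of \<open>Y\<close> form a directed family,
  so their union is a congruence; it contains \<open>Y\<close> and hence
  \<open>Cg ar A Y\<close>.\<close>

lemma Cg_finitary:
  assumes "is_alg ar A" "Y \<subseteq> acar A \<times> acar A" "finite G" "G \<subseteq> Cg ar A Y"
  shows "\<exists>F\<subseteq>Y. finite F \<and> G \<subseteq> Cg ar A F"
proof -
  let ?S = "{Cg ar A F | F. F \<subseteq> Y \<and> finite F}"
  have "\<Union>?S \<in> Con ar A"
  proof (rule directed_Union_in_Con[OF assms(1)])
    show "?S \<subseteq> Con ar A" using assms(1,2) by (auto intro: Cg_in_Con)
    show "?S \<noteq> {}" by blast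
    fix X Z assume "X \<in> ?S" "Z \<in> ?S"
    then obtain F F' where F: "F \<subseteq> Y" "finite F" "F' \<subseteq> Y" "finite F'" "X = Cg ar A F" "Z = Cg ar A F'"
      by blast
    have "X \<union> Z \<subseteq> Cg ar A (F \<union> F')"
      unfolding F using Cg_mono[of F "F \<union> F'" ar A] Cg_mono[of F' "F \<union> F'" ar A] by blast
    then show "\<exists>W\<in>?S. X \<union> Z \<subseteq> W" using F by blast
  qed
  moreover have "Y \<subseteq> \<Union>?S"
  proof
    fix p assume "p \<in> Y"
    then have "p \<in> Cg ar A {p}" "Cg ar A {p} \<in> ?S" using subset_Cg by blast+
    then show "p \<in> \<Union>?S" by blast
  qed
  ultimately have "Cg ar A Y \<subseteq> \<Union>?S" by (rule Cg_least)
  with assms(4) have "G \<subseteq> \<Union>?S" by (rule subset_trans)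
  with assms(3) show ?thesis
  proof (induction G)
    case empty
    then show ?case by blast
  next
    case (insert p G)
    then have "G \<subseteq> \<Union>?S" and "p \<in> \<Union>?S" by simp_all
    from insert.IH[OF this(1)] obtain F where F: "F \<subseteq> Y" "finite F" "G \<subseteq> Cg ar A F" by blast
    from \<open>p \<in> \<Union>?S\<close> obtain F' where F': "F' \<subseteq> Y" "finite F'" "p \<in> Cg ar A F'" by blast
    have "insert p G \<subseteq> Cg ar A (F \<union> F')"
      using F(3) F'(3) Cg_mono[of F "F \<union> F'" ar A] Cg_mono[of F' "F \<union> F'" ar A] by blast
    then show ?case using F F' by (intro exI[of _ "F \<union> F'"]) simp
  qed
qed

lemma Cg_finite_in_K:
  assumes "is_alg ar A" "G \<subseteq> acar A \<times> acar A" "finite G"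
  shows "Cg ar A G \<in> K ar A"
  unfolding K_def
proof (intro CollectI conjI allI impI)
  show "Cg ar A G \<in> Con ar A" using assms(1,2) by (rule Cg_in_Con)
  fix S assume S: "S \<subseteq> Con ar A" "Cg ar A G \<subseteq> Cg ar A (\<Union>S)"
  have car: "\<Union>S \<subseteq> acar A \<times> acar A"
    using S(1) Con_subset[of _ ar A] by (simp add: Sup_le_iff subset_iff[of S])
  moreover have "G \<subseteq> Cg ar A (\<Union>S)"
    using S(2) subset_Cg[of G ar A] by (rule subset_trans[rotated])
  ultimately have "\<exists>F\<subseteq>\<Union>S. finite F \<and> G \<subseteq> Cg ar A F"
    by (intro Cg_finitary assms)
  then obtain F where F: "F \<subseteq> \<Union>S" "finite F" "G \<subseteq> Cg ar A F" by blast
  \<comment> \<open>Finitely many members of \<open>S\<close> cover the finite set \<open>F\<close>;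
    they form the finite subfamily that compactness asks for.\<close>
  obtain T where T: "finite T" "T \<subseteq> S" "F \<subseteq> \<Union>T"
    by (rule finite_subset_Union[OF F(2,1)])
  have "Cg ar A (\<Union>T) \<in> Con ar A"
    using car T(2) by (intro Cg_in_Con assms(1)) blast
  then have "Cg ar A G \<subseteq> Cg ar A (\<Union>T)"
    using F(3) Cg_mono[OF T(3), of ar A] by (intro Cg_least) simp_all
  then show "\<exists>T\<subseteq>S. finite T \<and> Cg ar A G \<subseteq> Cg ar A (\<Union>T)" using T by blast
qed

section \<open>Joins as transitive closures\<close>

text \<open>Lists related entrywise by \<open>T\<^sup>+\<close> are joined by a finite chain of
  lists, each step changing one entry along \<open>T\<close>, so compatibility with single changes
  suffices.\<close>

lemma trancl_in_Con:
  assumes "is_alg ar A" "T \<subseteq> acar A \<times> acar A" "refl_on (acar A) T" "sym T"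
    and compat: "\<And>f xs ys. length xs = ar f \<Longrightarrow> set xs \<subseteq> acar A \<Longrightarrow> (xs, ys) \<in> listrel1 T
      \<Longrightarrow> (aop A f xs, aop A f ys) \<in> T"
  shows "T\<^sup>+ \<in> Con ar A"
proof (rule ConI)
  show sub: "T\<^sup>+ \<subseteq> acar A \<times> acar A" using assms(2) by (rule trancl_subset_Sigma)
  show "(x, x) \<in> T\<^sup>+" if "x \<in> acar A" for x
    using that assms(3) by (auto simp: refl_on_def)
  show "(y, x) \<in> T\<^sup>+" if "(x, y) \<in> T\<^sup>+" for x y
    using that sym_trancl[OF assms(4)] by (auto dest: symD)
  show "(x, z) \<in> T\<^sup>+" if "(x, y) \<in> T\<^sup>+" "(y, z) \<in> T\<^sup>+" for x y z
    using that by (rule trancl_trans)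
next
  fix f xs ys assume l: "length xs = ar f" "list_all2 (\<lambda>x y. (x, y) \<in> T\<^sup>+) xs ys"
  have xs: "set xs \<subseteq> acar A"
    using list_all2_carrier(1)[OF l(2)] trancl_subset_Sigma[OF assms(2)] by blast
  have "list_all2 (\<lambda>x y. (x, y) \<in> T\<^sup>*) xs ys"
    using l(2) by (rule list_all2_mono) (rule trancl_into_rtrancl)
  then have "(xs, ys) \<in> listrel (T\<^sup>*)"
    by (simp add: listrel_iff_zip list_all2_iff)
  then have "(xs, ys) \<in> (listrel1 T)\<^sup>*"
    by (simp add: listrel_rtrancl_eq_rtrancl_listrel1)
  then have "length ys = ar f \<and> set ys \<subseteq> acar A \<and> (aop A f xs, aop A f ys) \<in> T\<^sup>+"
  proof (induction rule: rtrancl_induct)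
    case base
    then show ?case
      using l xs is_algD[OF assms(1)] assms(3) by (auto simp: refl_on_def)
  next
    case (step ys zs)
    then have "(aop A f ys, aop A f zs) \<in> T" using compat by blast
    moreover have "length zs = ar f" using step listrel1_eq_len by metis
    moreover have "set zs \<subseteq> acar A" using step assms(2) by (auto elim!: listrel1E)
    ultimately show ?case using step by (auto intro: trancl_into_trancl)
  qed
  then show "(aop A f xs, aop A f ys) \<in> T\<^sup>+" by simp
qed

text \<open>This is the join of the two congruences. A single change uses a pair from one of them,
  and that congruence alone relates the results.\<close>

lemma trancl_Un_in_Con:
  assumes "is_alg ar A" "\<theta> \<in> Con ar A" "\<psi> \<in> Con ar A"
  shows "(\<theta> \<union> \<psi>)\<^sup>+ \<in> Con ar A"
proof (rule trancl_in_Con[OF assms(1)])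
  show "\<theta> \<union> \<psi> \<subseteq> acar A \<times> acar A" using Con_subset assms by blast
  show "refl_on (acar A) (\<theta> \<union> \<psi>)" using assms by (auto simp: refl_on_def Con_refl)
  show "sym (\<theta> \<union> \<psi>)" using assms by (auto intro!: symI intro: Con_sym)
  fix f xs ys assume l: "length xs = ar f" "set xs \<subseteq> acar A" "(xs, ys) \<in> listrel1 (\<theta> \<union> \<psi>)"
  from l(3) obtain x y us vs where *: "(x, y) \<in> \<theta> \<union> \<psi>" "xs = us @ x # vs" "ys = us @ y # vs"
    by (rule listrel1E)
  have "(aop A f xs, aop A f ys) \<in> \<chi>" if "(x, y) \<in> \<chi>" "\<chi> \<in> Con ar A" for \<chi>
    by (rule Con_compat[OF that(2) l(1)])
      (use * l(2) that in \<open>auto intro!: list_all2_appendI list.rel_refl_strong Con_refl\<close>)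
  then show "(aop A f xs, aop A f ys) \<in> \<theta> \<union> \<psi>" using * assms by blast
qed

section \<open>Terms and homomorphisms\<close>

lemma eval_in_carrier:
  assumes "is_alg ar A" "wf_trm ar t" "\<And>v. \<sigma> v \<in> acar A"
  shows "eval A \<sigma> t \<in> acar A"
  using assms(2)
proof (induction t)
  case (Fn f ts)
  then show ?case by (auto simp: list_all_iff intro!: is_algD[OF assms(1)])
qed (simp add: assms(3))

lemma eval_Con:
  assumes "\<theta> \<in> Con ar A" "wf_trm ar t" "\<And>v. (\<sigma> v, \<tau> v) \<in> \<theta>"
  shows "(eval A \<sigma> t, eval A \<tau> t) \<in> \<theta>"
  using assms(2)
proof (induction t)
  case (Fn f ts)
  then show ?case
    by (auto simp: list_all_iff list.rel_map intro!: Con_compat[OF assms(1)] list.rel_refl_strong)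
qed (simp add: assms(3))

lemma eval_map_trm: "eval A \<sigma> (map_trm id g t) = eval A (\<sigma> \<circ> g) t"
  by (induction t) (auto simp: comp_def cong: map_cong)

lemma wf_map_trm: "wf_trm ar (map_trm id g t) = wf_trm ar t"
  by (induction t) (auto simp: list_all_iff)

definition is_hom :: "('f \<Rightarrow> nat) \<Rightarrow> ('f,'a) alg \<Rightarrow> ('f,'b) alg \<Rightarrow> ('a \<Rightarrow> 'b) \<Rightarrow> bool" where
  "is_hom ar A B h \<longleftrightarrow> h ` acar A \<subseteq> acar B \<and>
     (\<forall>f xs. length xs = ar f \<and> set xs \<subseteq> acar A \<longrightarrow> h (aop A f xs) = aop B f (map h xs))"

lemma eval_hom:
  assumes "is_alg ar A" "is_hom ar A B h" "wf_trm ar t" "\<And>v. \<sigma> v \<in> acar A"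
  shows "eval B (\<lambda>v. h (\<sigma> v)) t = h (eval A \<sigma> t)"
  using assms(3)
proof (induction t)
  case (Fn f ts)
  then have "map (eval B (\<lambda>v. h (\<sigma> v))) ts = map h (map (eval A \<sigma>) ts)"
    by (auto simp: list_all_iff)
  moreover have "set (map (eval A \<sigma>) ts) \<subseteq> acar A"
    using Fn.prems assms(1,4) by (auto simp: list_all_iff intro!: eval_in_carrier)
  ultimately show ?case
    using assms(2) Fn.prems unfolding is_hom_def by (metis eval.simps(2) length_map wf_trm.simps(2))
qed simp

section \<open>Pullbacks, quotients and isomorphic copies\<close>

definition kernel_pullback :: "('f,'a) alg \<Rightarrow> ('a \<Rightarrow> 'b) \<Rightarrow> ('b \<times> 'b) set \<Rightarrow> ('a \<times> 'a) set" where
  "kernel_pullback A h \<theta> = {(x, y). x \<in> acar A \<and> y \<in> acar A \<and> (h x, h y) \<in> \<theta>}"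

lemma kernel_pullback_iff [simp]:
  "(x, y) \<in> kernel_pullback A h \<theta> \<longleftrightarrow> x \<in> acar A \<and> y \<in> acar A \<and> (h x, h y) \<in> \<theta>"
  by (simp add: kernel_pullback_def)

lemma kernel_pullback_in_Con:
  assumes "is_alg ar A" "is_hom ar A B h" "\<theta> \<in> Con ar B"
  shows "kernel_pullback A h \<theta> \<in> Con ar A"
proof (rule ConI)
  show sub: "kernel_pullback A h \<theta> \<subseteq> acar A \<times> acar A" by auto
  fix f xs ys
  assume l: "length xs = ar f" "length ys = ar f"
    "list_all2 (\<lambda>x y. (x, y) \<in> kernel_pullback A h \<theta>) xs ys"
  have c: "set xs \<subseteq> acar A" "set ys \<subseteq> acar A"
    using list_all2_carrier[OF l(3) sub] by auto
  have "list_all2 (\<lambda>x y. (x, y) \<in> \<theta>) (map h xs) (map h ys)"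
    using l(3) by (auto simp: list.rel_map elim: list_all2_mono)
  then have "(aop B f (map h xs), aop B f (map h ys)) \<in> \<theta>"
    using l by (intro Con_compat[OF assms(3)]) auto
  then show "(aop A f xs, aop A f ys) \<in> kernel_pullback A h \<theta>"
    using assms(1,2) l c by (simp add: is_algD is_hom_def)
qed (use assms in \<open>auto simp: is_hom_def intro: Con_refl Con_sym Con_trans\<close>)

lemma in_V_is_alg: "in_V ar E A \<Longrightarrow> is_alg ar A"
  by (simp add: in_V_def)

text \<open>The quotient of \<open>A\<close> by the kernel of \<open>g\<close>, realised on the range of \<open>g\<close>. The type of the
  range is arbitrary, so that quotients and isomorphic copies of algebras on other types can be
  moved into the types over which the variety is given.\<close>

definition image_alg :: "('f,'a) alg \<Rightarrow> ('a \<Rightarrow> 'b) \<Rightarrow> ('f,'b) alg" where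
  "image_alg A g = \<lparr>acar = g ` acar A,
     aop = (\<lambda>f xs. g (aop A f (map (inv_into (acar A) g) xs)))\<rparr>"

text \<open>Each argument and the representative that \<open>inv_into\<close> chooses for its image
  are kernel-related; compatibility of the kernel makes the result independent of the
  choice.\<close>

lemma image_alg_hom:
  assumes "is_alg ar A" "kernel_pullback A g Id \<in> Con ar A"
  shows "is_hom ar A (image_alg A g) g"
  unfolding is_hom_def
proof (intro conjI allI impI)
  fix f xs assume l: "length xs = ar f \<and> set xs \<subseteq> acar A"
  let ?s = "inv_into (acar A) g"
  have "(aop A f xs, aop A f (map (?s \<circ> g) xs)) \<in> kernel_pullback A g Id"
    using l by (intro Con_compat[OF assms(2)])
      (auto simp: list.rel_map f_inv_into_f inv_into_into intro!: list.rel_refl_strong)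
  then show "g (aop A f xs) = aop (image_alg A g) f (map g xs)"
    by (simp add: image_alg_def)
qed (simp add: image_alg_def)

text \<open>An assignment into the image lifts through \<open>inv_into\<close> to one into
  \<open>A\<close>, where the equation holds; \<open>g\<close> carries it back.\<close>

lemma image_alg_in_V:
  assumes wf: "\<forall>(s,t)\<in>E. wf_trm ar s \<and> wf_trm ar t"
    and V: "in_V ar E A" and ker: "kernel_pullback A g Id \<in> Con ar A"
  shows "in_V ar E (image_alg A g)"
proof -
  have alg: "is_alg ar A" by (rule in_V_is_alg[OF V])
  let ?s = "inv_into (acar A) g"
  have s: "?s y \<in> acar A" "g (?s y) = y" if "y \<in> g ` acar A" for y
    using that by (auto simp: inv_into_into f_inv_into_f)
  have "is_alg ar (image_alg A g)"
    unfolding is_alg_def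
  proof (intro conjI allI impI)
    show "acar (image_alg A g) \<noteq> {}" using alg by (auto simp: is_alg_def image_alg_def)
    fix f xs assume l: "length xs = ar f \<and> set xs \<subseteq> acar (image_alg A g)"
    then have "set (map ?s xs) \<subseteq> acar A" using s(1) by (auto simp: image_alg_def)
    then have "aop A f (map ?s xs) \<in> acar A" using l by (intro is_algD[OF alg]) simp_all
    then show "aop (image_alg A g) f xs \<in> acar (image_alg A g)" by (simp add: image_alg_def)
  qed
  moreover have "eval (image_alg A g) \<sigma> l = eval (image_alg A g) \<sigma> r"
    if "(l, r) \<in> E" "range \<sigma> \<subseteq> g ` acar A" for l r \<sigma>
  proof -
    have s': "?s (\<sigma> v) \<in> acar A" for v using that(2) s by auto
    have eq: "(\<lambda>v. g (?s (\<sigma> v))) = \<sigma>" using that(2) s by (auto simp: fun_eq_iff)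
    have "eval (image_alg A g) \<sigma> t = g (eval A (\<lambda>v. ?s (\<sigma> v)) t)" if "wf_trm ar t" for t
      using eval_hom[OF alg image_alg_hom[OF alg ker] that, of "\<lambda>v. ?s (\<sigma> v)"] s' eq by simp
    moreover have "eval A (\<lambda>v. ?s (\<sigma> v)) l = eval A (\<lambda>v. ?s (\<sigma> v)) r"
      using V that(1) s' unfolding in_V_def satisfies_def by (fastforce simp: image_subset_iff)
    ultimately show ?thesis using wf that(1) by auto
  qed
  ultimately show ?thesis
    unfolding in_V_def satisfies_def by (auto simp: image_alg_def)
qed

text \<open>The class of \<open>x\<close> is a subalgebra, so it becomes a one-element subalgebra of
  the quotient, which semidegeneracy then forces to be trivial. The injection \<open>h\<close>
  places the quotient on the type \<open>'u\<close> over which the variety is given.\<close>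

lemma idempotent_class_imp_Nabla:
  fixes h :: "'b \<Rightarrow> 'u" and B :: "('f,'b) alg"
  assumes wf: "\<forall>(s,t)\<in>E. wf_trm ar s \<and> wf_trm ar t" and std: "std_V TYPE('u) ar E"
    and V: "in_V ar E B" and inj: "inj_on h (acar B)"
    and \<theta>: "\<theta> \<in> Con ar B" and x: "x \<in> acar B"
    and idem: "\<And>f. (aop B f (replicate (ar f) x), x) \<in> \<theta>"
  shows "\<theta> = Nabla B"
proof -
  have alg: "is_alg ar B" by (rule in_V_is_alg[OF V])
  \<comment> \<open>\<open>r\<close> chooses one representative per class, so
    \<open>h \<circ> r\<close> has kernel \<open>\<theta>\<close> on the carrier and takes values in
    \<open>'u\<close>.\<close>
  define r where "r y = (SOME z. (y, z) \<in> \<theta>)" for y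
  have r: "(y, r y) \<in> \<theta>" if "y \<in> acar B" for y
    unfolding r_def using Con_refl[OF \<theta> that] by (rule someI)
  have r_eq: "r y = r z" if "(y, z) \<in> \<theta>" for y z
  proof -
    have "(y, w) \<in> \<theta> \<longleftrightarrow> (z, w) \<in> \<theta>" for w
      using that Con_sym[OF \<theta>] Con_trans[OF \<theta>] by blast
    then show ?thesis by (simp add: r_def)
  qed
  have r_car: "r y \<in> acar B" if "y \<in> acar B" for y using r[OF that] Con_subset[OF \<theta>] by blast
  define g where "g = h \<circ> r"
  have "(y, z) \<in> kernel_pullback B g Id \<longleftrightarrow> (y, z) \<in> \<theta>" for y z
  proof
    assume a: "(y, z) \<in> kernel_pullback B g Id"
    then have "r y = r z" using inj r_car by (auto simp: g_def dest: inj_onD)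
    with a show "(y, z) \<in> \<theta>" using r Con_sym[OF \<theta>] Con_trans[OF \<theta>] by (metis kernel_pullback_iff)
  qed (use Con_subset[OF \<theta>] r_eq in \<open>auto simp: g_def\<close>)
  then have ker_eq: "kernel_pullback B g Id = \<theta>" by (auto simp del: kernel_pullback_iff)
  then have ker: "kernel_pullback B g Id \<in> Con ar B" using \<theta> by simp
  let ?C = "image_alg B g"
  have hom: "is_hom ar B ?C g" using image_alg_hom[OF alg ker] .
  have C: "in_V ar E ?C" using image_alg_in_V[OF wf V ker] .
  have "subuniverse ar ?C {g x}"
    unfolding subuniverse_def
  proof (intro conjI allI impI)
    show "{g x} \<subseteq> acar ?C" using x by (simp add: image_alg_def)
    fix f xs assume "length xs = ar f \<and> set xs \<subseteq> {g x}"
    then have "xs = map g (replicate (ar f) x)"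
      by (metis map_replicate replicate_eqI singletonD subsetD)
    moreover have "g (aop B f (replicate (ar f) x)) = aop ?C f (map g (replicate (ar f) x))"
      using hom x unfolding is_hom_def by (metis length_replicate set_replicate_conv_if empty_subsetI insert_subset)
    ultimately show "aop ?C f xs \<in> {g x}" using idem[of f] ker_eq by (metis kernel_pullback_iff pair_in_Id_conv singletonI)
  qed
  moreover have "g x \<in> acar ?C" using x by (simp add: image_alg_def)
  ultimately have "\<exists>x\<in>acar ?C. subuniverse ar ?C {x}" ..
  moreover have "(\<exists>x\<in>acar ?C. \<exists>y\<in>acar ?C. x \<noteq> y) \<longrightarrow> \<not> (\<exists>x\<in>acar ?C. subuniverse ar ?C {x})"
    using std C unfolding std_V_def by simp
  ultimately have trivial: "\<not> (\<exists>y\<in>acar ?C. \<exists>z\<in>acar ?C. y \<noteq> z)" by argo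
  have "g y = g z" if "y \<in> acar B" "z \<in> acar B" for y z
  proof (rule ccontr)
    assume "g y \<noteq> g z"
    moreover have "g y \<in> acar ?C" "g z \<in> acar ?C" using that by (simp_all add: image_alg_def)
    ultimately show False using trivial by blast
  qed
  then have "Nabla B \<subseteq> kernel_pullback B g Id" unfolding Nabla_def kernel_pullback_def by blast
  with ker_eq Con_subset[OF \<theta>] show ?thesis by (simp add: Nabla_def)
qed

text \<open>The modular law for \<open>\<alpha> \<subseteq> \<gamma>\<close>, along a path witnessing membership in \<open>\<beta> \<circ> \<alpha> \<circ> \<beta>\<close>.\<close>

lemma modular_path:
  fixes h :: "'b \<Rightarrow> 'u" and B :: "('f,'b) alg"
  assumes wf: "\<forall>(s,t)\<in>E. wf_trm ar s \<and> wf_trm ar t" and std: "std_V TYPE('u) ar E"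
    and V: "in_V ar E B" and inj: "inj_on h (acar B)"
    and con: "\<alpha> \<in> Con ar B" "\<beta> \<in> Con ar B" "\<gamma> \<in> Con ar B" "\<kappa> \<in> Con ar B"
    and sub: "\<alpha> \<subseteq> \<gamma>" "\<alpha> \<subseteq> \<kappa>" "\<beta> \<inter> \<gamma> \<subseteq> \<kappa>"
    and path: "(p, q) \<in> \<gamma>" "(p, r) \<in> \<beta>" "(r, s) \<in> \<alpha>" "(s, q) \<in> \<beta>"
  shows "(p, q) \<in> \<kappa>"
proof -
  have alg: "is_alg ar B" by (rule in_V_is_alg[OF V])
  \<comment> \<open>Since \<open>h\<close> is injective on the carrier, \<open>?C\<close> is an
    isomorphic copy of \<open>B\<close> on the type \<open>'u\<close>.\<close>
  have "kernel_pullback B h Id = Delta B"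
    using inj by (auto simp: Delta_def kernel_pullback_def dest: inj_onD)
  then have ker: "kernel_pullback B h Id \<in> Con ar B" using Delta_in_Con[OF alg] by simp
  let ?C = "image_alg B h"
  let ?s = "inv_into (acar B) h"
  have C: "in_V ar E ?C" using image_alg_in_V[OF wf V ker] .
  have algC: "is_alg ar ?C" by (rule in_V_is_alg[OF C])
  have "is_hom ar ?C B ?s"
    unfolding is_hom_def
  proof (intro conjI allI impI)
    show "?s ` acar ?C \<subseteq> acar B" by (auto simp: image_alg_def inv_into_into)
    fix f xs assume l: "length xs = ar f \<and> set xs \<subseteq> acar ?C"
    then have "set (map ?s xs) \<subseteq> acar B" by (auto simp: image_alg_def inv_into_into)
    then have "aop B f (map ?s xs) \<in> acar B" using l by (intro is_algD[OF alg]) auto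
    then show "?s (aop ?C f xs) = aop B f (map ?s xs)"
      using inj by (simp add: image_alg_def)
  qed
  then have G: "kernel_pullback ?C ?s \<theta> \<in> Con ar ?C" if "\<theta> \<in> Con ar B" for \<theta>
    using kernel_pullback_in_Con[OF algC] that by blast
  let ?G = "kernel_pullback ?C ?s"
  have G_iff: "(h x, h y) \<in> ?G \<theta> \<longleftrightarrow> (x, y) \<in> \<theta>" if "\<theta> \<in> Con ar B" "x \<in> acar B" "y \<in> acar B" for x y \<theta>
    using that inj by (simp add: image_alg_def)
  have car: "p \<in> acar B" "q \<in> acar B" "r \<in> acar B" "s \<in> acar B"
    using path con Con_subset by blast+
  let ?J = "cjoin ar ?C (?G \<alpha>) (?G \<beta>)"
  have J: "?J \<in> Con ar ?C"
    unfolding cjoin_def using Con_subset[OF G[OF con(1)]] Con_subset[OF G[OF con(2)]]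
    by (intro Cg_in_Con algC) blast
  have "?G \<alpha> \<union> ?G \<beta> \<subseteq> ?J" unfolding cjoin_def by (rule subset_Cg)
  moreover have "(h p, h r) \<in> ?G \<beta>" "(h r, h s) \<in> ?G \<alpha>" "(h s, h q) \<in> ?G \<beta>"
    using G_iff car path con by auto
  ultimately have "(h p, h q) \<in> ?J" using Con_trans[OF J] by blast
  then have "(h p, h q) \<in> ?J \<inter> ?G \<gamma>" using G_iff car path con by simp
  also have "?J \<inter> ?G \<gamma> = cjoin ar ?C (?G \<alpha>) (?G \<beta> \<inter> ?G \<gamma>)"
  proof -
    have "?G \<alpha> \<subseteq> ?G \<gamma>" using sub(1) by auto
    then show ?thesis
      using std C G[OF con(1)] G[OF con(2)] G[OF con(3)] unfolding std_V_def by blast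
  qed
  also have "\<dots> \<subseteq> ?G \<kappa>"
    unfolding cjoin_def using sub by (intro Cg_least G con) auto
  finally show ?thesis using G_iff car con by blast
qed

section \<open>Congruences as subalgebras of the square\<close>

definition square_alg :: "('f,'a) alg \<Rightarrow> ('a \<times> 'a) set \<Rightarrow> ('f,'a \<times> 'a) alg" where
  "square_alg A \<theta> = \<lparr>acar = \<theta>, aop = (\<lambda>f ps. (aop A f (map fst ps), aop A f (map snd ps)))\<rparr>"

lemma acar_square_alg [simp]: "acar (square_alg A \<theta>) = \<theta>"
  by (simp add: square_alg_def)

lemma aop_square_alg [simp]:
  "aop (square_alg A \<theta>) f ps = (aop A f (map fst ps), aop A f (map snd ps))"
  by (simp add: square_alg_def)

lemma eval_square_alg:
  "eval (square_alg A \<theta>) \<sigma> t = (eval A (fst \<circ> \<sigma>) t, eval A (snd \<circ> \<sigma>) t)"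
  by (induction t) (auto simp: comp_def cong: map_cong)

lemma square_alg_in_V:
  assumes "in_V ar E A" "\<theta> \<in> Con ar A"
  shows "in_V ar E (square_alg A \<theta>)"
  unfolding in_V_def
proof
  have alg: "is_alg ar A" by (rule in_V_is_alg[OF assms(1)])
  then obtain x where "x \<in> acar A" by (auto simp: is_alg_def)
  then have "\<theta> \<noteq> {}" using Con_refl[OF assms(2)] by blast
  moreover have "(aop A f (map fst ps), aop A f (map snd ps)) \<in> \<theta>"
    if "length ps = ar f" "set ps \<subseteq> \<theta>" for f ps
    using that by (intro Con_compat[OF assms(2)]) (auto simp: list.rel_map intro!: list.rel_refl_strong)
  ultimately show "is_alg ar (square_alg A \<theta>)" by (simp add: is_alg_def)
  have "eval (square_alg A \<theta>) \<sigma> s = eval (square_alg A \<theta>) \<sigma> t"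
    if "(s, t) \<in> E" "range \<sigma> \<subseteq> \<theta>" for s t \<sigma>
  proof -
    have "\<sigma> v \<in> acar A \<times> acar A" for v using that(2) Con_subset[OF assms(2)] by blast
    then have "range (fst \<circ> \<sigma>) \<subseteq> acar A" "range (snd \<circ> \<sigma>) \<subseteq> acar A"
      by (auto simp: mem_Times_iff)
    then show ?thesis
      using assms(1) that(1) unfolding in_V_def satisfies_def eval_square_alg by blast
  qed
  then show "satisfies (square_alg A \<theta>) E" by (auto simp: satisfies_def)
qed

lemma fst_hom: "\<theta> \<in> Con ar A \<Longrightarrow> is_hom ar (square_alg A \<theta>) A fst"
  using Con_subset by (force simp: is_hom_def)

lemma snd_hom: "\<theta> \<in> Con ar A \<Longrightarrow> is_hom ar (square_alg A \<theta>) A snd"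
  using Con_subset by (force simp: is_hom_def)

lemma diagonal_hom: "\<theta> \<in> Con ar A \<Longrightarrow> is_hom ar A (square_alg A \<theta>) (\<lambda>x. (x, x))"
  by (auto simp: is_hom_def comp_def Con_refl)

text \<open>Gumm's Shifting Lemma: apply the modular law in the congruence lattice of \<open>\<theta>\<close>, regarded
  as an algebra, to the path \<open>(z,z) \<rightarrow> (x,x) \<rightarrow> (x,y) \<rightarrow> (z,u)\<close>.\<close>

lemma shifting:
  fixes h :: "'b \<times> 'b \<Rightarrow> 'u" and B :: "('f,'b) alg"
  assumes wf: "\<forall>(s,t)\<in>E. wf_trm ar s \<and> wf_trm ar t" and std: "std_V TYPE('u) ar E"
    and V: "in_V ar E B" and inj: "inj_on h \<theta>"
    and con: "\<theta> \<in> Con ar B" "\<psi> \<in> Con ar B" "\<gamma> \<in> Con ar B"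
    and sub: "\<theta> \<inter> \<psi> \<subseteq> \<gamma>"
    and rect: "(x, y) \<in> \<theta>" "(z, u) \<in> \<theta>" "(x, z) \<in> \<psi>" "(y, u) \<in> \<psi>" "(x, y) \<in> \<gamma>"
  shows "(z, u) \<in> \<gamma>"
proof -
  have alg: "is_alg ar B" by (rule in_V_is_alg[OF V])
  let ?T = "square_alg B \<theta>"
  have VT: "in_V ar E ?T" by (rule square_alg_in_V[OF V con(1)])
  have algT: "is_alg ar ?T" by (rule in_V_is_alg[OF VT])
  let ?p0 = "kernel_pullback ?T fst" and ?p1 = "kernel_pullback ?T snd"
  have p0: "?p0 \<chi> \<in> Con ar ?T" and p1: "?p1 \<chi> \<in> Con ar ?T" if "\<chi> \<in> Con ar B" for \<chi>
    using kernel_pullback_in_Con[OF algT fst_hom[OF con(1)] that]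
      kernel_pullback_in_Con[OF algT snd_hom[OF con(1)] that] .
  have D: "Delta B \<in> Con ar B" by (rule Delta_in_Con[OF alg])
  have car: "x \<in> acar B" "y \<in> acar B" "z \<in> acar B" "u \<in> acar B"
    using rect Con_subset con by blast+
  have "((z, z), (z, u)) \<in> ?p1 \<gamma>"
  proof (rule modular_path[OF wf std VT])
    show "inj_on h (acar ?T)" using inj by simp
    show "?p0 (Delta B) \<inter> ?p1 \<gamma> \<in> Con ar ?T" by (intro Int_in_Con p0 p1 D con)
    show "?p0 \<psi> \<inter> ?p1 \<psi> \<in> Con ar ?T" by (intro Int_in_Con p0 p1 con)
    show "?p0 (Delta B) \<in> Con ar ?T" by (intro p0 D)
    show "?p1 \<gamma> \<in> Con ar ?T" by (intro p1 con)
    \<comment> \<open>Two such elements share their first coordinate, to which \<open>b\<close> and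
      \<open>b'\<close> are both \<open>\<theta>\<close>-related; hence \<open>(b, b')\<close> lies
      in \<open>\<theta> \<inter> \<psi>\<close> and so in \<open>\<gamma>\<close>.\<close>
    show "?p0 \<psi> \<inter> ?p1 \<psi> \<inter> ?p0 (Delta B) \<subseteq> ?p1 \<gamma>"
    proof clarsimp
      fix a b a' b'
      assume "(a, b) \<in> \<theta>" "(a', b') \<in> \<theta>" "(b, b') \<in> \<psi>" "(a, a') \<in> Delta B"
      then have "(b, a) \<in> \<theta>" "(a, b') \<in> \<theta>"
        by (auto simp: Delta_def dest: Con_sym[OF con(1)])
      then have "(b, b') \<in> \<theta>" by (rule Con_trans[OF con(1)])
      then show "(b, b') \<in> \<gamma>" using sub \<open>(b, b') \<in> \<psi>\<close> by blast
    qed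
    show "((z, z), (z, u)) \<in> ?p0 (Delta B)"
      using car rect by (auto simp: Delta_def Con_refl[OF con(1)])
    show "((z, z), (x, x)) \<in> ?p0 \<psi> \<inter> ?p1 \<psi>"
      using car rect by (auto simp: Con_refl[OF con(1)] Con_sym[OF con(2)])
    show "((x, x), (x, y)) \<in> ?p0 (Delta B) \<inter> ?p1 \<gamma>"
      using car rect by (auto simp: Delta_def Con_refl[OF con(1)])
    show "((x, y), (z, u)) \<in> ?p0 \<psi> \<inter> ?p1 \<psi>"
      using car rect by auto
  qed auto
  then show ?thesis by simp
qed

section \<open>Maximal congruences are prime\<close>

text \<open>These are the two-by-two matrices of the term condition in \<open>centralizes\<close>,
  written as pairs of rows. For congruences \<open>\<alpha>\<close> and \<open>\<beta>\<close> the
  rows are \<open>\<beta>\<close>-pairs, hence elements of the algebra on \<open>\<beta>\<close>,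
  and the columns are \<open>\<alpha>\<close>-pairs.\<close>

definition term_matrices ::
  "('f \<Rightarrow> nat) \<Rightarrow> ('f,'a) alg \<Rightarrow> ('a \<times> 'a) set \<Rightarrow> ('a \<times> 'a) set \<Rightarrow> (('a \<times> 'a) \<times> ('a \<times> 'a)) set" where
  "term_matrices ar A \<alpha> \<beta> =
     {((eval A (case_sum a c) t, eval A (case_sum a d) t),
       (eval A (case_sum b c) t, eval A (case_sum b d) t)) |
      (t :: ('f, nat + nat) trm) a b c d.
        wf_trm ar t \<and> (\<forall>i. (a i, b i) \<in> \<alpha>) \<and> (\<forall>j. (c j, d j) \<in> \<beta>)}"

lemma term_matricesI:
  assumes "wf_trm ar (t :: ('f, nat + nat) trm)" "\<And>i. (a i, b i) \<in> \<alpha>" "\<And>j. (c j, d j) \<in> \<beta>"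
    and "p = (eval A (case_sum a c) t, eval A (case_sum a d) t)"
    and "q = (eval A (case_sum b c) t, eval A (case_sum b d) t)"
  shows "(p, q) \<in> term_matrices ar A \<alpha> \<beta>"
  unfolding term_matrices_def using assms by blast

lemma term_matricesE:
  assumes "(p, q) \<in> term_matrices ar A \<alpha> \<beta>"
  obtains t :: "('f, nat + nat) trm" and a b c d where
    "wf_trm ar t" "\<forall>i. (a i, b i) \<in> \<alpha>" "\<forall>j. (c j, d j) \<in> \<beta>"
    "p = (eval A (case_sum a c) t, eval A (case_sum a d) t)"
    "q = (eval A (case_sum b c) t, eval A (case_sum b d) t)"
  using assms unfolding term_matrices_def by blast

text \<open>Closure under the operations: rename the variables of the argument terms apart, variable
  \<open>k\<close> of the \<open>i\<close>-th term becoming \<open>prod_encode (i, k)\<close>.\<close>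

lemma term_matrices_compat:
  fixes A :: "('f,'a) alg"
  assumes "\<alpha> \<noteq> {}" "\<beta> \<noteq> {}"
    and "length ps = ar f" "list_all2 (\<lambda>p q. (p, q) \<in> term_matrices ar A \<alpha> \<beta>) ps qs"
  shows "(aop (square_alg A \<beta>) f ps, aop (square_alg A \<beta>) f qs) \<in> term_matrices ar A \<alpha> \<beta>"
proof -
  let ?n = "ar f"
  have len: "length qs = ?n" using assms(3,4) list_all2_lengthD by metis
  \<comment> \<open>The condition is stated for every \<open>i\<close> but leaves the values beyond
    the arity free, so that total families can be chosen.\<close>
  define good where "good i t a b c d \<longleftrightarrow>
    wf_trm ar (t :: ('f, nat + nat) trm) \<and> (\<forall>k. (a k, b k) \<in> \<alpha>) \<and> (\<forall>k. (c k, d k) \<in> \<beta>) \<and>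
    (i < ?n \<longrightarrow> ps ! i = (eval A (case_sum a c) t, eval A (case_sum a d) t)
      \<and> qs ! i = (eval A (case_sum b c) t, eval A (case_sum b d) t))"
    for i t and a b c d :: "nat \<Rightarrow> 'a"
  have "\<exists>t a b c d. good i t a b c d" for i
  proof (cases "i < ?n")
    case True
    then have "(ps ! i, qs ! i) \<in> term_matrices ar A \<alpha> \<beta>"
      using assms(3,4) by (simp add: list_all2_conv_all_nth)
    then show ?thesis by (rule term_matricesE) (unfold good_def, blast)
  next
    case False
    obtain x y where "(x, y) \<in> \<alpha>" using assms(1) by auto
    moreover obtain v w where "(v, w) \<in> \<beta>" using assms(2) by auto
    ultimately have "good i (Var (Inl 0)) (\<lambda>_. x) (\<lambda>_. y) (\<lambda>_. v) (\<lambda>_. w)"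
      using False by (simp add: good_def)
    then show ?thesis by blast
  qed
  then obtain t a b c d where g: "\<And>i. good i (t i) (a i) (b i) (c i) (d i)" by metis
  define ren where "ren i = map_sum (\<lambda>k::nat. prod_encode (i, k)) (\<lambda>k::nat. prod_encode (i, k))" for i
  \<comment> \<open>Splitting \<open>k\<close> by \<open>prod_decode\<close> returns each renamed
    variable to its own assignment, so the renamed \<open>i\<close>-th term evaluates as the
    original one did.\<close>
  define mrg where "mrg s k = s (fst (prod_decode k)) (snd (prod_decode k))"
    for s :: "nat \<Rightarrow> nat \<Rightarrow> 'a" and k
  have ren: "case_sum (mrg s) (mrg s') \<circ> ren i = case_sum (s i) (s' i)" for s s' i
    by (auto simp: fun_eq_iff ren_def mrg_def split: sum.split)
  let ?t = "Fn f (map (\<lambda>i. map_trm id (ren i) (t i)) [0..<?n])"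
  have ev: "eval A (case_sum (mrg s) (mrg s')) ?t = aop A f (map (\<lambda>i. eval A (case_sum (s i) (s' i)) (t i)) [0..<?n])"
    for s s'
    by (simp add: eval_map_trm ren o_def[of "eval A _"] cong: map_cong)
  have eqs: "map fst ps = map (\<lambda>i. eval A (case_sum (a i) (c i)) (t i)) [0..<?n]"
    "map snd ps = map (\<lambda>i. eval A (case_sum (a i) (d i)) (t i)) [0..<?n]"
    "map fst qs = map (\<lambda>i. eval A (case_sum (b i) (c i)) (t i)) [0..<?n]"
    "map snd qs = map (\<lambda>i. eval A (case_sum (b i) (d i)) (t i)) [0..<?n]"
    using g assms(3) len by (auto simp: good_def intro!: nth_equalityI)
  show ?thesis
  proof (rule term_matricesI[where t = ?t and a = "mrg a" and b = "mrg b" and c = "mrg c" and d = "mrg d"])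
    show "wf_trm ar ?t" using g by (auto simp: list_all_iff wf_map_trm good_def)
    show "(mrg a i, mrg b i) \<in> \<alpha>" "(mrg c i, mrg d i) \<in> \<beta>" for i
      using g by (auto simp: mrg_def good_def)
  qed (simp_all only: ev eqs aop_square_alg)
qed

text \<open>The matrices already form a reflexive, symmetric and compatible relation on the algebra
  on \<open>\<beta>\<close>; only transitivity has to be added.\<close>

lemma term_matrices_trancl_in_Con:
  fixes A :: "('f,'a) alg"
  assumes V: "in_V ar E A" and con: "\<alpha> \<in> Con ar A" "\<beta> \<in> Con ar A"
  shows "(term_matrices ar A \<alpha> \<beta>)\<^sup>+ \<in> Con ar (square_alg A \<beta>)"
proof (rule trancl_in_Con)
  have alg: "is_alg ar A" by (rule in_V_is_alg[OF V])
  show "is_alg ar (square_alg A \<beta>)" by (rule in_V_is_alg[OF square_alg_in_V[OF V con(2)]])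
  obtain x where x: "x \<in> acar A" using alg by (auto simp: is_alg_def)
  have xx: "(x, x) \<in> \<alpha>" "(x, x) \<in> \<beta>" using Con_refl[OF _ x] con by auto
  show refl: "refl_on (acar (square_alg A \<beta>)) (term_matrices ar A \<alpha> \<beta>)"
    unfolding refl_on_def
  proof
    fix p assume "p \<in> acar (square_alg A \<beta>)"
    \<comment> \<open>The term is a single y-variable, so both rows equal \<open>p\<close> whatever
      the x-values are.\<close>
    then show "(p, p) \<in> term_matrices ar A \<alpha> \<beta>"
      by (intro term_matricesI[where t = "Var (Inr 0)" and a = "\<lambda>_. x" and b = "\<lambda>_. x"
            and c = "\<lambda>_. fst p" and d = "\<lambda>_. snd p"]) (auto simp: xx)
  qed
  show "sym (term_matrices ar A \<alpha> \<beta>)"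
  proof (rule symI)
    fix p q assume "(p, q) \<in> term_matrices ar A \<alpha> \<beta>"
    then show "(q, p) \<in> term_matrices ar A \<alpha> \<beta>"
      by (rule term_matricesE) (rule term_matricesI, auto intro: Con_sym[OF con(1)])
  qed
  show "term_matrices ar A \<alpha> \<beta> \<subseteq> acar (square_alg A \<beta>) \<times> acar (square_alg A \<beta>)"
  proof clarify
    fix p1 p2 q1 q2 assume "((p1, p2), (q1, q2)) \<in> term_matrices ar A \<alpha> \<beta>"
    then obtain t :: "('f, nat + nat) trm" and a b c d where
      *: "wf_trm ar t" "\<forall>i. (a i, b i) \<in> \<alpha>" "\<forall>j. (c j, d j) \<in> \<beta>"
      "(p1, p2) = (eval A (case_sum a c) t, eval A (case_sum a d) t)"
      "(q1, q2) = (eval A (case_sum b c) t, eval A (case_sum b d) t)"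
      by (rule term_matricesE)
    have "a i \<in> acar A" "b i \<in> acar A" for i using *(2) Con_subset[OF con(1)] by blast+
    \<comment> \<open>Within a row only the y-variables change, and they change along
      \<open>\<beta>\<close>.\<close>
    then have "(case_sum a c v, case_sum a d v) \<in> \<beta>" "(case_sum b c v, case_sum b d v) \<in> \<beta>" for v
      using *(3) by (cases v; simp add: Con_refl[OF con(2)])+
    then show "(p1, p2) \<in> acar (square_alg A \<beta>) \<and> (q1, q2) \<in> acar (square_alg A \<beta>)"
      using *(4,5) eval_Con[OF con(2) *(1), of "case_sum a c" "case_sum a d"]
        eval_Con[OF con(2) *(1), of "case_sum b c" "case_sum b d"] by simp
  qed
  fix f xs ys
  assume l: "length xs = ar f" "set xs \<subseteq> acar (square_alg A \<beta>)" "(xs, ys) \<in> listrel1 (term_matrices ar A \<alpha> \<beta>)"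
  have "list_all2 (\<lambda>p q. (p, q) \<in> term_matrices ar A \<alpha> \<beta>) xs ys"
    using l(3)
  proof (rule listrel1E)
    fix x y us vs assume *: "(x, y) \<in> term_matrices ar A \<alpha> \<beta>" "xs = us @ x # vs" "ys = us @ y # vs"
    then show ?thesis
      using l(2) refl
      by (auto simp del: acar_square_alg simp: refl_on_def intro!: list_all2_appendI list.rel_refl_strong)
  qed
  then show "(aop (square_alg A \<beta>) f xs, aop (square_alg A \<beta>) f ys) \<in> term_matrices ar A \<alpha> \<beta>"
    using xx l(1) by (intro term_matrices_compat) auto
qed


section \<open>The commutator and the term condition\<close>

text \<open>The term condition passes to intersections: a premise in the commutator holds modulo
  each \<open>\<delta>\<close>, and so does the conclusion.\<close>

lemma centralizes_comm:
  fixes A :: "('f,'a) alg"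
  shows "centralizes ar A \<alpha> \<beta> (comm ar A \<alpha> \<beta>)"
  unfolding centralizes_def
proof (intro allI impI)
  fix t :: "('f, nat + nat) trm" and a b c d
  assume t: "wf_trm ar t" "(\<forall>i. (a i, b i) \<in> \<alpha>) \<and> (\<forall>j. (c j, d j) \<in> \<beta>)"
    and *: "(eval A (case_sum a c) t, eval A (case_sum a d) t) \<in> comm ar A \<alpha> \<beta>"
  show "(eval A (case_sum b c) t, eval A (case_sum b d) t) \<in> comm ar A \<alpha> \<beta>"
    unfolding comm_def
  proof
    fix \<delta> assume \<delta>: "\<delta> \<in> {\<delta> \<in> Con ar A. centralizes ar A \<alpha> \<beta> \<delta>}"
    then have "(eval A (case_sum a c) t, eval A (case_sum a d) t) \<in> \<delta>"
      using * unfolding comm_def by blast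
    then show "(eval A (case_sum b c) t, eval A (case_sum b d) t) \<in> \<delta>"
      using \<delta> t unfolding centralizes_def by blast
  qed
qed

text \<open>The term condition holds modulo \<open>\<alpha>\<close>: the chain t(b,c), t(a,c),
  t(a,d), t(b,d) moves along \<open>\<alpha>\<close> at each step, the middle one by the
  premise.\<close>

lemma comm_subset_left:
  fixes A :: "('f,'a) alg"
  assumes "\<alpha> \<in> Con ar A" "\<beta> \<in> Con ar A"
  shows "comm ar A \<alpha> \<beta> \<subseteq> \<alpha>"
proof -
  have "centralizes ar A \<alpha> \<beta> \<alpha>"
    unfolding centralizes_def
  proof (intro allI impI)
    fix t :: "('f, nat + nat) trm" and a b c d :: "nat \<Rightarrow> 'a"
    assume t: "wf_trm ar t" and ab: "(\<forall>i. (a i, b i) \<in> \<alpha>) \<and> (\<forall>j. (c j, d j) \<in> \<beta>)"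
      and *: "(eval A (case_sum a c) t, eval A (case_sum a d) t) \<in> \<alpha>"
    have "c j \<in> acar A" "d j \<in> acar A" for j using ab Con_subset[OF assms(2)] by blast+
    then have "(case_sum b c v, case_sum a c v) \<in> \<alpha>" "(case_sum a d v, case_sum b d v) \<in> \<alpha>" for v
      using ab by (cases v; simp add: Con_refl[OF assms(1)] Con_sym[OF assms(1)])+
    then have "(eval A (case_sum b c) t, eval A (case_sum a c) t) \<in> \<alpha>"
      "(eval A (case_sum a d) t, eval A (case_sum b d) t) \<in> \<alpha>"
      by (intro eval_Con[OF assms(1) t]; simp)+
    with * show "(eval A (case_sum b c) t, eval A (case_sum b d) t) \<in> \<alpha>"
      using Con_trans[OF assms(1)] by blast
  qed
  then show ?thesis using assms(1) unfolding comm_def by blast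
qed

text \<open>Modulo \<open>\<beta>\<close> the conclusion of the term condition always holds, since
  each row is a \<open>\<beta>\<close>-pair.\<close>

lemma comm_subset_right:
  fixes A :: "('f,'a) alg"
  assumes "\<alpha> \<in> Con ar A" "\<beta> \<in> Con ar A"
  shows "comm ar A \<alpha> \<beta> \<subseteq> \<beta>"
proof -
  have "centralizes ar A \<alpha> \<beta> \<beta>"
    unfolding centralizes_def
  proof (intro allI impI)
    fix t :: "('f, nat + nat) trm" and a b c d :: "nat \<Rightarrow> 'a"
    assume t: "wf_trm ar t" and ab: "(\<forall>i. (a i, b i) \<in> \<alpha>) \<and> (\<forall>j. (c j, d j) \<in> \<beta>)"
    have "b i \<in> acar A" for i using ab Con_subset[OF assms(1)] by blast
    then have "(case_sum b c v, case_sum b d v) \<in> \<beta>" for v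
      using ab by (cases v) (simp_all add: Con_refl[OF assms(2)])
    then show "(eval A (case_sum b c) t, eval A (case_sum b d) t) \<in> \<beta>"
      by (rule eval_Con[OF assms(2) t])
  qed
  then show ?thesis using assms(2) unfolding comm_def by blast
qed

text \<open>\<open>h\<close> starts from the fourth power because the Shifting Lemma is applied to
  the algebra on \<open>\<beta>\<close> and passes to the square of that algebra.\<close>

lemma maximal_prime:
  fixes h :: "('a \<times> 'a) \<times> ('a \<times> 'a) \<Rightarrow> 'u" and A :: "('f,'a) alg"
  assumes wf: "\<forall>(s,t)\<in>E. wf_trm ar s \<and> wf_trm ar t" and std: "std_V TYPE('u) ar E"
    and V: "in_V ar E A" and inj: "inj h"
    and max: "\<phi> \<in> MaxC ar A" and \<alpha>: "\<alpha> \<in> Con ar A" and \<beta>: "\<beta> \<in> Con ar A"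
    and comm: "comm ar A \<alpha> \<beta> \<subseteq> \<phi>" and n\<alpha>: "\<not> \<alpha> \<subseteq> \<phi>"
  shows "\<beta> \<subseteq> \<phi>"
proof -
  have alg: "is_alg ar A" by (rule in_V_is_alg[OF V])
  have \<phi>: "\<phi> \<in> Con ar A" using max by (simp add: MaxC_def)
  let ?R = "square_alg A \<beta>"
  have VR: "in_V ar E ?R" by (rule square_alg_in_V[OF V \<beta>])
  have algR: "is_alg ar ?R" by (rule in_V_is_alg[OF VR])
  let ?p0 = "kernel_pullback ?R fst" and ?p1 = "kernel_pullback ?R snd"
  have p0: "?p0 \<chi> \<in> Con ar ?R" and p1: "?p1 \<chi> \<in> Con ar ?R" if "\<chi> \<in> Con ar A" for \<chi>
    using kernel_pullback_in_Con[OF algR fst_hom[OF \<beta>] that]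
      kernel_pullback_in_Con[OF algR snd_hom[OF \<beta>] that] .
  have Delta: "Delta A \<in> Con ar A" by (rule Delta_in_Con[OF alg])
  have \<beta>_refl: "(x, x) \<in> \<beta>" if "x \<in> acar A" for x using Con_refl[OF \<beta> that] .
  have \<beta>_car: "x \<in> acar A" "y \<in> acar A" if "(x, y) \<in> \<beta>" for x y
    using that Con_subset[OF \<beta>] by auto
  have shift: "(z, u) \<in> \<gamma>"
    if "\<theta> \<in> Con ar ?R" "\<psi> \<in> Con ar ?R" "\<gamma> \<in> Con ar ?R" "\<theta> \<inter> \<psi> \<subseteq> \<gamma>"
      "(x, y) \<in> \<theta>" "(z, u) \<in> \<theta>" "(x, z) \<in> \<psi>" "(y, u) \<in> \<psi>" "(x, y) \<in> \<gamma>" for \<theta> \<psi> \<gamma> x y z u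
    using shifting[OF wf std VR inj_on_subset[OF inj subset_UNIV] that] .
  \<comment> \<open>Intersecting with \<open>?p0 \<alpha>\<close> ensures that first coordinates of
    related elements are \<open>\<alpha>\<close>-related, so that \<open>diag\<close> can be applied
    to them.\<close>
  define \<Delta> where "\<Delta> = (term_matrices ar A \<alpha> \<beta>)\<^sup>+ \<inter> ?p0 \<alpha>"
  have \<Delta>: "\<Delta> \<in> Con ar ?R"
    unfolding \<Delta>_def by (intro Int_in_Con term_matrices_trancl_in_Con[OF V] p0 \<alpha> \<beta>)
  have diag: "((x, x), (y, y)) \<in> \<Delta>" if "(x, y) \<in> \<alpha>" for x y
  proof -
    have car: "x \<in> acar A" "y \<in> acar A" using that Con_subset[OF \<alpha>] by auto
    then have "((x, x), (y, y)) \<in> term_matrices ar A \<alpha> \<beta>"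
      by (intro term_matricesI[where t = "Var (Inl 0)" and a = "\<lambda>_. x" and b = "\<lambda>_. y"
            and c = "\<lambda>_. x" and d = "\<lambda>_. x"]) (auto simp: that \<beta>_refl)
    then show ?thesis using that car \<beta>_refl by (auto simp: \<Delta>_def)
  qed
  \<comment> \<open>The term condition carries membership in the commutator from row to row along a
    chain of matrices.\<close>
  have comm_closed: "q \<in> comm ar A \<alpha> \<beta>" if "(p, q) \<in> \<Delta>" "p \<in> comm ar A \<alpha> \<beta>" for p q
  proof -
    have "(p, q) \<in> (term_matrices ar A \<alpha> \<beta>)\<^sup>+" using that by (simp add: \<Delta>_def)
    moreover have step: "q' \<in> comm ar A \<alpha> \<beta>"
      if "(p', q') \<in> term_matrices ar A \<alpha> \<beta>" "p' \<in> comm ar A \<alpha> \<beta>" for p' q'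
    proof -
      from that(1) obtain t :: "('f, nat + nat) trm" and a b c d where
        "wf_trm ar t" "\<forall>i. (a i, b i) \<in> \<alpha>" "\<forall>j. (c j, d j) \<in> \<beta>"
        "p' = (eval A (case_sum a c) t, eval A (case_sum a d) t)"
        "q' = (eval A (case_sum b c) t, eval A (case_sum b d) t)"
        by (rule term_matricesE)
      then show ?thesis
        using that(2) centralizes_comm[of ar A \<alpha> \<beta>] unfolding centralizes_def by blast
    qed
    ultimately show ?thesis using that(2) by (induction rule: trancl_induct) blast+
  qed
  have Delta_comm: "(x, x) \<in> comm ar A \<alpha> \<beta>" if "x \<in> acar A" for x
    using that by (auto simp: comm_def intro: Con_refl)
  have \<Delta>_fibre: "?p0 (Delta A) \<inter> \<Delta> \<subseteq> ?p1 \<phi>"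
  proof clarsimp
    fix x y x' z
    assume *: "((x, y), (x', z)) \<in> \<Delta>" "(x, y) \<in> \<beta>" "(x', z) \<in> \<beta>" "(x, x') \<in> Delta A"
    then have [simp]: "x' = x" by (auto simp: Delta_def)
    have "(y, x) \<in> \<beta>" "(x, z) \<in> \<beta>" using * by (auto dest: Con_sym[OF \<beta>])
    then have yz: "(y, z) \<in> \<beta>" by (rule Con_trans[OF \<beta>])
    have car: "x \<in> acar A" "y \<in> acar A" "z \<in> acar A" using * \<beta>_car by auto
    \<comment> \<open>First shift: the related elements \<open>(x, y)\<close> and
      \<open>(x, z)\<close> are moved, with second coordinates fixed, to first coordinate
      \<open>y\<close>. As \<open>(y, y)\<close> is in the commutator, so is
      \<open>(y, z)\<close>.\<close>
    have "((y, y), (y, z)) \<in> \<Delta>"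
    proof (rule shift[where \<theta> = "?p0 (Delta A)" and \<psi> = "?p1 (Delta A)"])
      show "?p0 (Delta A) \<inter> ?p1 (Delta A) \<subseteq> \<Delta>"
        using Con_refl[OF \<Delta>] by (auto simp: Delta_def)
    qed (use * yz car \<beta>_refl in \<open>auto simp: Delta_def p0[OF Delta, unfolded Delta_def]
        p1[OF Delta, unfolded Delta_def] \<Delta>\<close>)
    then have "(y, z) \<in> comm ar A \<alpha> \<beta>" using comm_closed Delta_comm car by blast
    then show "(y, z) \<in> \<phi>" using comm by blast
  qed
  have \<phi>_closed: "(x', y') \<in> \<phi>" if *: "((x, y), (x', y')) \<in> \<Delta>" "(x, y) \<in> \<phi>" for x y x' y'
  proof -
    have R: "(x, y) \<in> \<beta>" "(x', y') \<in> \<beta>" using *(1) Con_subset[OF \<Delta>] by auto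
    have car: "x \<in> acar A" "y \<in> acar A" "x' \<in> acar A" "y' \<in> acar A" using R \<beta>_car by auto
    have "(x, x') \<in> \<alpha>" using *(1) by (simp add: \<Delta>_def)
    then have "((x, x), (x', x')) \<in> \<Delta>" by (rule diag)
    \<comment> \<open>Second shift, from \<open>(x, x)\<close>, \<open>(x, y)\<close> to
      \<open>(x', x')\<close>, \<open>(x', y')\<close> along \<open>\<Delta>\<close>; its condition
      on the intersection is \<open>\<Delta>_fibre\<close>.\<close>
    then have "((x', x'), (x', y')) \<in> ?p1 \<phi>"
      by (rule_tac shift[where \<theta> = "?p0 (Delta A)" and \<psi> = \<Delta> and x = "(x, x)" and y = "(x, y)"])
        (use * R car \<beta>_refl \<Delta>_fibre p0[OF Delta] p1[OF \<phi>] \<Delta> in \<open>auto simp: Delta_def\<close>)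
    then show ?thesis by simp
  qed
  define \<omega> where "\<omega> = (\<Delta> \<union> (?p0 \<phi> \<inter> ?p1 \<phi>))\<^sup>+"
  have \<omega>: "\<omega> \<in> Con ar ?R"
    unfolding \<omega>_def by (intro trancl_Un_in_Con Int_in_Con algR \<Delta> p0 p1 \<phi>)
  have box_closed: "(x', y') \<in> \<phi>" if "(x, x') \<in> \<phi>" "(y, y') \<in> \<phi>" "(x, y) \<in> \<phi>" for x y x' y'
    using Con_trans[OF \<phi> Con_trans[OF \<phi> Con_sym[OF \<phi> that(1)] that(3)] that(2)] .
  have \<omega>_closed: "q \<in> \<phi>" if "(p, q) \<in> \<omega>" "p \<in> \<phi>" for p q
    using that unfolding \<omega>_def
  proof (induction rule: trancl_induct)
    case (base q)
    then show ?case
      by (cases p; cases q) (auto intro: \<phi>_closed box_closed)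
  next
    case (step q q')
    then show ?case
      by (cases q; cases q') (auto intro: \<phi>_closed box_closed)
  qed
  have \<omega>_diag: "((x, x), (y, y)) \<in> \<omega>" if "x \<in> acar A" "y \<in> acar A" for x y
  proof -
    \<comment> \<open>Pulling \<open>\<omega>\<close> back along the diagonal gives a congruence of
      \<open>A\<close> above both \<open>\<alpha>\<close> and \<open>\<phi>\<close>; as
      \<open>\<phi>\<close> is maximal and does not contain \<open>\<alpha>\<close>, it is
      full.\<close>
    let ?d = "kernel_pullback A (\<lambda>x. (x, x)) \<omega>"
    have d: "?d \<in> Con ar A" by (rule kernel_pullback_in_Con[OF alg diagonal_hom[OF \<beta>] \<omega>])
    have "\<alpha> \<subseteq> ?d"
    proof clarify
      fix x y assume "(x, y) \<in> \<alpha>"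
      then show "(x, y) \<in> ?d"
        using diag[of x y] Con_subset[OF \<alpha>] by (auto simp: \<omega>_def)
    qed
    moreover have "\<phi> \<subseteq> ?d"
    proof clarify
      fix x y assume "(x, y) \<in> \<phi>"
      then show "(x, y) \<in> ?d"
        using Con_subset[OF \<phi>] \<beta>_refl by (auto simp: \<omega>_def intro!: r_into_trancl)
    qed
    ultimately have "?d = Nabla A" using max d n\<alpha> unfolding MaxC_def by blast
    then have "(x, y) \<in> ?d" using that by (simp only: Nabla_def mem_Sigma_iff)
    then show ?thesis by simp
  qed
  obtain x where x: "x \<in> acar A" using alg by (auto simp: is_alg_def)
  \<comment> \<open>Operations applied to \<open>(x, x)\<close> stay on the diagonal, which lies in
    a single \<open>\<omega>\<close>-class.\<close>
  have "\<omega> = Nabla ?R"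
  proof (rule idempotent_class_imp_Nabla[OF wf std VR _ \<omega>])
    show "inj_on (\<lambda>p. h (p, p)) (acar ?R)" using inj by (auto intro!: inj_onI dest: injD)
    show "(x, x) \<in> acar ?R" using x \<beta>_refl by simp
    show "(aop ?R f (replicate (ar f) (x, x)), (x, x)) \<in> \<omega>" for f
      using x by (auto intro!: \<omega>_diag is_algD[OF alg])
  qed
  show ?thesis
  proof clarify
    fix c d assume cd: "(c, d) \<in> \<beta>"
    then have "((c, c), (c, d)) \<in> \<omega>"
      using \<open>\<omega> = Nabla ?R\<close> \<beta>_car \<beta>_refl by (auto simp: Nabla_def)
    then show "(c, d) \<in> \<phi>" using \<omega>_closed Con_refl[OF \<phi>] \<beta>_car[OF cd] by blast
  qed
qed

text \<open>For infinite \<open>'a\<close> the square injects into \<open>'a\<close>; for finite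
  \<open>'a\<close> the fourth power is finite and injects into the summand
  \<open>nat\<close>.\<close>

lemma ex_inj_fourth_power:
  "\<exists>h :: ('a \<times> 'a) \<times> ('a \<times> 'a) \<Rightarrow> 'a + nat. inj h"
proof (cases "finite (UNIV :: 'a set)")
  case True
  then have "finite (UNIV :: (('a \<times> 'a) \<times> ('a \<times> 'a)) set)"
    by (simp add: finite_prod)
  then obtain g :: "('a \<times> 'a) \<times> ('a \<times> 'a) \<Rightarrow> nat" where "inj g"
    using finite_imp_inj_to_nat_seg by blast
  then have "inj (Inr \<circ> g :: _ \<Rightarrow> 'a + nat)" by (auto intro: inj_compose)
  then show ?thesis by blast
next
  case False
  obtain g :: "'a \<times> 'a \<Rightarrow> 'a" where g: "inj g"
    using card_of_Times_same_infinite[OF False] card_of_ordIso[of "UNIV \<times> UNIV :: ('a \<times> 'a) set" "UNIV :: 'a set"]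
    by (auto simp: bij_betw_def)
  then have "inj (\<lambda>(p, q). Inl (g (g p, g q)) :: 'a + nat)"
    by (auto intro!: injI dest!: injD[OF g])
  then show ?thesis by blast
qed

lemma MaxC_subset_Spec:
  fixes A :: "('f,'a) alg"
  assumes "\<forall>(s,t)\<in>E. wf_trm ar s \<and> wf_trm ar t" "std_V TYPE('a + nat) ar E" "in_V ar E A"
  shows "MaxC ar A \<subseteq> Spec ar A"
proof
  fix \<phi> assume \<phi>: "\<phi> \<in> MaxC ar A"
  obtain h :: "('a \<times> 'a) \<times> ('a \<times> 'a) \<Rightarrow> 'a + nat" where "inj h"
    using ex_inj_fourth_power by blast
  then have "\<beta> \<subseteq> \<phi>" if "\<alpha> \<in> Con ar A" "\<beta> \<in> Con ar A" "comm ar A \<alpha> \<beta> \<subseteq> \<phi>" "\<not> \<alpha> \<subseteq> \<phi>" for \<alpha> \<beta>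
    using maximal_prime[OF assms _ \<phi> that] by blast
  moreover have "\<phi> \<in> Con ar A" "\<phi> \<noteq> Nabla A" using \<phi> by (simp_all add: MaxC_def)
  ultimately show "\<phi> \<in> Spec ar A" unfolding Spec_def by simp blast
qed

section \<open>Compactness of the full congruence\<close>

lemma Nabla_finitely_generated:
  fixes ar :: "'f \<Rightarrow> nat" and A :: "('f,'a) alg"
  assumes fin: "finite (UNIV :: 'f set)"
    and wf: "\<forall>(s,t)\<in>E. wf_trm ar s \<and> wf_trm ar t" and std: "std_V TYPE('a) ar E" and V: "in_V ar E A"
  obtains G where "finite G" "G \<subseteq> Nabla A" "Cg ar A G = Nabla A"
proof -
  have alg: "is_alg ar A" by (rule in_V_is_alg[OF V])
  obtain x where x: "x \<in> acar A" using alg by (auto simp: is_alg_def)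
  \<comment> \<open>One pair per operation symbol, hence finitely many as the signature is
    finite.\<close>
  let ?G = "range (\<lambda>f. (aop A f (replicate (ar f) x), x))"
  have sub: "?G \<subseteq> Nabla A" using x by (auto simp: Nabla_def intro!: is_algD[OF alg])
  have "Cg ar A ?G = Nabla A"
  proof (rule idempotent_class_imp_Nabla[OF wf std V inj_on_id _ x])
    show "Cg ar A ?G \<in> Con ar A" using sub by (intro Cg_in_Con alg) (simp add: Nabla_def)
    show "(aop A f (replicate (ar f) x), x) \<in> Cg ar A ?G" for f
      using subset_Cg[of ?G] by blast
  qed
  then show thesis using that[of ?G] fin sub by simp
qed

text \<open>Zorn's lemma applies: a chain with full union would have the finite set \<open>G\<close>
  inside one member, and that member would already be full.\<close>

lemma ex_MaxC_above:
  assumes alg: "is_alg ar A" and G: "finite G" "Cg ar A G = Nabla A"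
    and \<theta>: "\<theta> \<in> Con ar A" "\<theta> \<noteq> Nabla A"
  shows "\<exists>\<phi>\<in>MaxC ar A. \<theta> \<subseteq> \<phi>"
proof -
  let ?S = "{\<psi> \<in> Con ar A. \<theta> \<subseteq> \<psi> \<and> \<psi> \<noteq> Nabla A}"
  have "\<exists>M\<in>?S. \<forall>X\<in>?S. M \<subseteq> X \<longrightarrow> X = M"
  proof (rule subset_Zorn_nonempty)
    show "?S \<noteq> {}" using \<theta> by blast
    fix C assume C: "C \<noteq> {}" "subset.chain ?S C"
    then have C': "C \<subseteq> ?S" "\<And>X Y. X \<in> C \<Longrightarrow> Y \<in> C \<Longrightarrow> X \<subseteq> Y \<or> Y \<subseteq> X"
      by (auto simp: subset_chain_def)
    have con: "\<Union>C \<in> Con ar A"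
    proof (rule directed_Union_in_Con[OF alg _ C(1)])
      show "C \<subseteq> Con ar A" using C'(1) by blast
      show "\<exists>Z\<in>C. X \<union> Y \<subseteq> Z" if "X \<in> C" "Y \<in> C" for X Y
        using C'(2)[OF that] that by (auto intro: bexI[of _ X] bexI[of _ Y])
    qed
    have "\<Union>C \<noteq> Nabla A"
    proof
      assume "\<Union>C = Nabla A"
      then have "G \<subseteq> \<Union>C" using G(2) subset_Cg[of G ar A] by simp
      then obtain X where "X \<in> C" "G \<subseteq> X"
        by (rule finite_subset_Union_chain[OF G(1) _ C])
      then have "Nabla A \<subseteq> X" "X \<in> ?S" using Cg_least[of X ar A G] G(2) C'(1) by auto
      then show False using Con_subset[of X ar A] by (auto simp: Nabla_def)
    qed
    then show "\<Union>C \<in> ?S" using con C(1) C'(1) by blast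
  qed
  then obtain M where "M \<in> ?S" "\<forall>X\<in>?S. M \<subseteq> X \<longrightarrow> X = M" by blast
  then have "M \<in> MaxC ar A" "\<theta> \<subseteq> M" unfolding MaxC_def by blast+
  then show ?thesis by blast
qed

text \<open>Finitely many pairs from \<open>\<theta> \<union> \<chi>\<close> already generate all of
  \<open>G\<close>; splitting them by origin gives generators of the two compact
  congruences.\<close>

lemma compact_refinement_of_Nabla:
  assumes alg: "is_alg ar A" and G: "finite G" "Cg ar A G = Nabla A"
    and con: "\<theta> \<in> Con ar A" "\<chi> \<in> Con ar A" and join: "cjoin ar A \<theta> \<chi> = Nabla A"
  obtains \<alpha> \<beta> where "\<alpha> \<in> K ar A" "\<beta> \<in> K ar A" "\<alpha> \<subseteq> \<theta>" "\<beta> \<subseteq> \<chi>" "cjoin ar A \<alpha> \<beta> = Nabla A"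
proof -
  have sub: "\<theta> \<union> \<chi> \<subseteq> acar A \<times> acar A" using con Con_subset by blast
  have "G \<subseteq> Cg ar A (\<theta> \<union> \<chi>)" using join G(2) subset_Cg[of G ar A] by (simp add: cjoin_def)
  then obtain F where F: "F \<subseteq> \<theta> \<union> \<chi>" "finite F" "G \<subseteq> Cg ar A F"
    using Cg_finitary[OF alg sub G(1)] by blast
  let ?\<alpha> = "Cg ar A (F \<inter> \<theta>)" and ?\<beta> = "Cg ar A (F \<inter> \<chi>)"
  have K: "?\<alpha> \<in> K ar A" "?\<beta> \<in> K ar A"
    using F sub by (auto intro!: Cg_finite_in_K[OF alg])
  have le: "?\<alpha> \<subseteq> \<theta>" "?\<beta> \<subseteq> \<chi>" by (intro Cg_least con Int_lower2)+
  have J: "cjoin ar A ?\<alpha> ?\<beta> \<in> Con ar A"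
    unfolding cjoin_def using le sub by (intro Cg_in_Con alg) blast
  have "F \<subseteq> ?\<alpha> \<union> ?\<beta>" using F(1) subset_Cg[of "F \<inter> \<theta>" ar A] subset_Cg[of "F \<inter> \<chi>" ar A] by blast
  then have "Cg ar A F \<subseteq> cjoin ar A ?\<alpha> ?\<beta>" unfolding cjoin_def by (rule Cg_mono)
  then have "Nabla A \<subseteq> cjoin ar A ?\<alpha> ?\<beta>"
    using Cg_least[OF J, of G] F(3) G(2) by auto
  then have "cjoin ar A ?\<alpha> ?\<beta> = Nabla A"
    using Con_subset[OF J] by (auto simp: Nabla_def)
  then show thesis using that K le by blast
qed

section \<open>Clopen sets of maximal congruences\<close>

theorem theorem5p14:
  fixes ar :: "'f \<Rightarrow> nat"
    and E :: "(('f,nat) trm \<times> ('f,nat) trm) set"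
    and A :: "('f,'a) alg"
    and U :: "('a \<times> 'a) set set"
  assumes "finite (UNIV :: 'f set)"
    and "\<forall>(s,t)\<in>E. wf_trm ar s \<and> wf_trm ar t"
    and "std_V TYPE('a) ar E"
    and "std_V TYPE('a + nat) ar E"
    and "in_V ar E A"
    and "U \<subseteq> MaxC ar A"
  shows "Max_clopen ar A U \<longleftrightarrow>
    (\<exists>\<alpha>\<in>K ar A. \<exists>\<beta>\<in>K ar A. cjoin ar A \<alpha> \<beta> = Nabla A \<and> comm ar A \<alpha> \<beta> \<subseteq> Rad ar A \<and>
        U = MaxC ar A \<inter> D ar A \<alpha>)"
proof
  have alg: "is_alg ar A" by (rule in_V_is_alg[OF assms(5)])
  have spec: "MaxC ar A \<subseteq> Spec ar A" by (rule MaxC_subset_Spec[OF assms(2,4,5)])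
  \<comment> \<open>Since maximal congruences are prime, the trace of \<open>D ar A \<theta>\<close>
    can be read off from inclusion alone.\<close>
  have trace: "MaxC ar A \<inter> D ar A \<theta> = {\<phi> \<in> MaxC ar A. \<not> \<theta> \<subseteq> \<phi>}" for \<theta>
    using spec by (auto simp: D_def)
  have not_both: "\<not> (\<theta> \<subseteq> \<phi> \<and> \<chi> \<subseteq> \<phi>)"
    if "\<phi> \<in> MaxC ar A" "cjoin ar A \<theta> \<chi> = Nabla A" for \<phi> \<theta> \<chi>
  proof
    assume "\<theta> \<subseteq> \<phi> \<and> \<chi> \<subseteq> \<phi>"
    moreover have "\<phi> \<in> Con ar A" "\<phi> \<noteq> Nabla A" using that by (auto simp: MaxC_def)
    ultimately show False
      using Cg_least[of \<phi> ar A "\<theta> \<union> \<chi>"] Con_subset[of \<phi> ar A] that(2) by (auto simp: cjoin_def Nabla_def)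
  qed
  {
    assume "Max_clopen ar A U"
    then obtain \<theta> \<chi> where \<theta>: "\<theta> \<in> Con ar A" "U = MaxC ar A \<inter> D ar A \<theta>"
      and \<chi>: "\<chi> \<in> Con ar A" "MaxC ar A - U = MaxC ar A \<inter> D ar A \<chi>"
      unfolding Max_clopen_def Max_open_def by blast
    \<comment> \<open>\<open>U\<close> and its complement are the traces of \<open>\<theta>\<close>
      and \<open>\<chi>\<close>, so each maximal congruence contains exactly one of the two.\<close>
    have split: "(\<theta> \<subseteq> \<phi>) \<longleftrightarrow> \<not> \<chi> \<subseteq> \<phi>" if "\<phi> \<in> MaxC ar A" for \<phi>
      using that \<theta>(2) \<chi>(2) unfolding trace by blast
    obtain G where G: "finite G" "Cg ar A G = Nabla A"
      by (rule Nabla_finitely_generated[OF assms(1,2,3,5)])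
    have J: "cjoin ar A \<theta> \<chi> \<in> Con ar A"
      unfolding cjoin_def using \<theta>(1) \<chi>(1) Con_subset by (intro Cg_in_Con alg) blast
    have "\<theta> \<subseteq> cjoin ar A \<theta> \<chi>" "\<chi> \<subseteq> cjoin ar A \<theta> \<chi>"
      unfolding cjoin_def using subset_Cg[of "\<theta> \<union> \<chi>" ar A] by auto
    \<comment> \<open>A proper join would lie below a maximal congruence, which would contain
      both.\<close>
    then have "cjoin ar A \<theta> \<chi> = Nabla A"
      using ex_MaxC_above[OF alg G J] split by blast
    then obtain \<alpha> \<beta> where ab: "\<alpha> \<in> K ar A" "\<beta> \<in> K ar A" "\<alpha> \<subseteq> \<theta>" "\<beta> \<subseteq> \<chi>"
      "cjoin ar A \<alpha> \<beta> = Nabla A"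
      by (rule compact_refinement_of_Nabla[OF alg G \<theta>(1) \<chi>(1)])
    have con: "\<alpha> \<in> Con ar A" "\<beta> \<in> Con ar A" using ab by (auto simp: K_def)
    \<comment> \<open>One of \<open>\<theta>\<close>, \<open>\<chi>\<close> lies in
      \<open>\<phi>\<close>, and with it \<open>\<alpha>\<close> or \<open>\<beta>\<close>; the
      commutator is below both.\<close>
    have "comm ar A \<alpha> \<beta> \<subseteq> \<phi>" if "\<phi> \<in> MaxC ar A" for \<phi>
      using split[OF that] ab(3,4) comm_subset_left[OF con] comm_subset_right[OF con] by blast
    moreover have "comm ar A \<alpha> \<beta> \<subseteq> Nabla A"
      using comm_subset_left[OF con] Con_subset[OF con(1)] by (auto simp: Nabla_def)
    ultimately have "comm ar A \<alpha> \<beta> \<subseteq> Rad ar A" unfolding Rad_def by blast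
    \<comment> \<open>If \<open>\<phi>\<close> contains \<open>\<alpha>\<close> but not
      \<open>\<theta>\<close>, it contains \<open>\<chi>\<close> and so \<open>\<beta>\<close>,
      against the full join of \<open>\<alpha>\<close> and \<open>\<beta>\<close>.\<close>
    moreover have "(\<theta> \<subseteq> \<phi>) \<longleftrightarrow> \<alpha> \<subseteq> \<phi>" if "\<phi> \<in> MaxC ar A" for \<phi>
      using split[OF that] ab(3,4) not_both[OF that ab(5)] by blast
    then have "U = MaxC ar A \<inter> D ar A \<alpha>" unfolding \<theta>(2) trace by blast
    ultimately show "\<exists>\<alpha>\<in>K ar A. \<exists>\<beta>\<in>K ar A. cjoin ar A \<alpha> \<beta> = Nabla A \<and> comm ar A \<alpha> \<beta> \<subseteq> Rad ar A \<and>
        U = MaxC ar A \<inter> D ar A \<alpha>"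
      using ab by blast
  }
  {
    assume "\<exists>\<alpha>\<in>K ar A. \<exists>\<beta>\<in>K ar A. cjoin ar A \<alpha> \<beta> = Nabla A \<and> comm ar A \<alpha> \<beta> \<subseteq> Rad ar A \<and>
        U = MaxC ar A \<inter> D ar A \<alpha>"
    then obtain \<alpha> \<beta> where con: "\<alpha> \<in> Con ar A" "\<beta> \<in> Con ar A" and join: "cjoin ar A \<alpha> \<beta> = Nabla A"
      and rad: "comm ar A \<alpha> \<beta> \<subseteq> Rad ar A" and U: "U = MaxC ar A \<inter> D ar A \<alpha>"
      by (auto simp: K_def)
    \<comment> \<open>Primality gives at least one of the two inclusions, the full join at most one;
      so the complement of \<open>U\<close> is the trace of \<open>\<beta>\<close>.\<close>
    have "(\<alpha> \<subseteq> \<phi>) \<longleftrightarrow> \<not> \<beta> \<subseteq> \<phi>" if "\<phi> \<in> MaxC ar A" for \<phi>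
    proof -
      have "comm ar A \<alpha> \<beta> \<subseteq> \<phi>" using rad that by (auto simp: Rad_def)
      then have "\<alpha> \<subseteq> \<phi> \<or> \<beta> \<subseteq> \<phi>" using spec that con unfolding Spec_def by blast
      then show ?thesis using not_both[OF that join] by blast
    qed
    then have "MaxC ar A - U = MaxC ar A \<inter> D ar A \<beta>" unfolding U trace by blast
    then show "Max_clopen ar A U"
      unfolding Max_clopen_def Max_open_def using U con assms(6) by blast
  }
qed

end
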